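(* Let $\mathcal{Q}$ be $\mathrm{SL}(3,\mathbb{R})$ or $\mathrm{GL}(3,\mathbb{R})$, and let $G=\mathrm{SO}(3)\times\mathrm{SO}(3)$ act on $\mathcal{Q}$ by left and right multiplication and on $T^*\mathcal{Q}$ by cotangent lift. Consider the affine rigid body on $T^*\mathcal{Q}$ with $G$-invariant potential energy. Suppose the potential energy has a minimum at the point $(I,0)\in T^*\mathcal{Q}$. Then there exist $\varepsilon_L, \varepsilon_R>0$ and a $G$-invariant neighbourhood $U$ of $(I,0)$ in $T^{*}\mathcal{Q}$ such that for all $(\mu_L, \mu_R) \in \mathfrak{so}(3)^*\times\mathfrak{so}(3)^*$ with $\|\mu_L\| < \varepsilon_L$ and $\|\mu_R\|<\varepsilon_R$ there is an extremal relative equilibrium of the affine rigid body in $U$ with momentum $(\Phi_L, \Phi_R)=(\mu_L, \mu_R)$.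
   Context: An affine rigid body models a mass of ideal fluid evolving in time in such a manner that it always remains an ellipsoid. Its configuration space is $\mathcal{Q}=\mathrm{SL}(3,\mathbb{R})$ (incompressible fluid) or $\mathcal{Q}=\mathrm{GL}(3,\mathbb{R})$ (compressible fluid); the matrix $Q\in\mathcal{Q}$ represents the configuration that is the image of a sphere under $Q$, an ellipsoid whose semi-axes are given by the singular values of $Q$. It is a Hamiltonian system on the cotangent bundle $T^*\mathcal{Q}$ with its canonical symplectic form, whose $G$-invariant Hamiltonian $h$ is the sum of the kinetic energy of the fluid motion (a positive definite quadratic form in the momentum) and a potential energy, a function of $Q$. The potential energy depends only on the shape of the ellipsoid, and so is invariant under $G=\mathrm{SO}(3)\times\mathrm{SO}(3)$, the first copy of $\mathrm{SO}(3)$ acting on $\mathcal{Q}$ by multiplication on the left and the second by multiplication on the right. $I$ is the identity matrix (the round sphere). Points of $T^*\mathcal{Q}$ are written $(Q,P)$ with $P$ a matrix representing a covector at $Q$. The momentum map $\Phi=(\Phi_L,\Phi_R)$ of the $G$-action on $T^*\mathcal{Q}$ has the two components $\Phi_L,\Phi_R:T^*\mathcal{Q}\to\mathfrak{so}(3)^*$, $$\Phi_L(Q,P)=\tfrac{1}{2}\left(PQ^T-QP^T\right),\qquad \Phi_R(Q,P)=\tfrac{1}{2}\left(P^TQ-Q^TP\right),$$ where $\mathfrak{so}(3)^*$ is identified with the skew-symmetric $3\times3$ matrices; $\|\cdot\|$ is a norm on $\mathfrak{so}(3)^*$. A trajectory of the Hamiltonian vector field of $h$ is a relative equilibrium if its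 image in $T^*\mathcal{Q}/G$ is a single point. A relative equilibrium with momentum value $\mu=(\mu_L,\mu_R)$ is extremal if its image in the reduced space $\Phi^{-1}(\mu)/G_\mu$ is a local extremum of the function induced by $h$ on that space, where $G_\mu$ is the isotropy subgroup of $\mu$ for the coadjoint action.
   Formalization: The minimum of the potential energy at (I,0) is taken to be strict among shapes: near I its value is attained only on the G-orbit of I. Without this the claim fails, e.g. on GL(3) with zero potential and kinetic energy |P|²/2. *)

theory Defs
  imports "HOL-Analysis.Analysis"
begin

type_synonym mat3 = "real^3^3"

section \<open>Orbit spaces\<close>

definition orbit :: "('g \<Rightarrow> 'x \<Rightarrow> 'x) \<Rightarrow> 'g set \<Rightarrow> 'x \<Rightarrow> 'x set" where
  "orbit a H x = (\<lambda>g. a g x) ` H"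

text \<open>The quotient topology on the set of orbits of points of \<open>S\<close>, where \<open>S\<close> carries the
  subspace topology.\<close>
definition orbit_topology ::
    "('g \<Rightarrow> 'x \<Rightarrow> 'x) \<Rightarrow> 'g set \<Rightarrow> 'x::topological_space set \<Rightarrow> 'x set topology" where
  "orbit_topology a H S =
     topology (\<lambda>W. W \<subseteq> orbit a H ` S \<and> openin (top_of_set S) {x \<in> S. orbit a H x \<in> W})"

lemma openin_orbit_topology:
  "openin (orbit_topology a H S) W \<longleftrightarrow>
     W \<subseteq> orbit a H ` S \<and> openin (top_of_set S) {x \<in> S. orbit a H x \<in> W}"
proof -
  let ?P = "\<lambda>W. W \<subseteq> orbit a H ` S \<and> openin (top_of_set S) {x \<in> S. orbit a H x \<in> W}"
  have "istopology ?P"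
    unfolding istopology_def
  proof (intro conjI allI impI)
    fix A B assume A: "?P A" and B: "?P B"
    show "A \<inter> B \<subseteq> orbit a H ` S" using A by blast
    have "{x \<in> S. orbit a H x \<in> A \<inter> B}
        = {x \<in> S. orbit a H x \<in> A} \<inter> {x \<in> S. orbit a H x \<in> B}" by blast
    then show "openin (top_of_set S) {x \<in> S. orbit a H x \<in> A \<inter> B}"
      using A B by (simp add: openin_Int)
  next
    fix K assume K: "\<forall>A\<in>K. ?P A"
    then show "\<Union>K \<subseteq> orbit a H ` S" by blast
    have "{x \<in> S. orbit a H x \<in> \<Union>K} = (\<Union>A\<in>K. {x \<in> S. orbit a H x \<in> A})" by blast
    moreover have "openin (top_of_set S) (\<Union>A\<in>K. {x \<in> S. orbit a H x \<in> A})"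
      using K by (intro openin_Union) blast
    ultimately show "openin (top_of_set S) {x \<in> S. orbit a H x \<in> \<Union>K}" by (simp only:)
  qed
  then show ?thesis
    unfolding orbit_topology_def by (simp add: topology_inverse')
qed

lemma topspace_orbit_topology: "topspace (orbit_topology a H S) = orbit a H ` S"
proof
  show "topspace (orbit_topology a H S) \<subseteq> orbit a H ` S"
    using openin_topspace[of "orbit_topology a H S"] unfolding openin_orbit_topology by blast
  have "{x \<in> S. orbit a H x \<in> orbit a H ` S} = S" by blast
  then have "openin (orbit_topology a H S) (orbit a H ` S)"
    by (simp add: openin_orbit_topology)
  then show "orbit a H ` S \<subseteq> topspace (orbit_topology a H S)"
    by (rule openin_subset)
qed

text \<open>The function induced on orbits; meaningful when \<open>f\<close> is constant on the orbit.\<close>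
definition induced :: "('x \<Rightarrow> 'b) \<Rightarrow> 'x set \<Rightarrow> 'b" where
  "induced f Ob = the_elem (f ` Ob)"

definition local_extremum :: "'a topology \<Rightarrow> ('a \<Rightarrow> real) \<Rightarrow> 'a \<Rightarrow> bool" where
  "local_extremum X f x \<longleftrightarrow>
     (\<exists>W. openin X W \<and> x \<in> W \<and> ((\<forall>y\<in>W. f x \<le> f y) \<or> (\<forall>y\<in>W. f y \<le> f x)))"

section \<open>Phase space\<close>

text \<open>The space of velocities of curves in \<open>S\<close> through \<open>x\<close>; only used for embedded
  submanifolds \<open>S\<close> of a Euclidean space.\<close>
definition tangent_space :: "'a::real_normed_vector set \<Rightarrow> 'a \<Rightarrow> 'a set" where
  "tangent_space S x = {v. \<exists>c :: real \<Rightarrow> 'a.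
     (\<forall>t. c t \<in> S) \<and> c 0 = x \<and> (c has_vector_derivative v) (at 0)}"

definition SL3 :: "mat3 set" where "SL3 = {Q. det Q = 1}"

definition GL3 :: "mat3 set" where "GL3 = {Q. invertible Q}"

text \<open>A covector at \<open>Q\<close> is represented by the unique \<open>P \<in> tangent_space Qs Q\<close> such that it is
  \<open>A \<mapsto> P \<bullet> A = tr (P\<^sup>T A)\<close> there. For \<open>GL(3)\<close> this is every matrix \<open>P\<close>, for \<open>SL(3)\<close>
  those with \<open>tr (Q\<^sup>-\<^sup>1 P) = 0\<close>; the other representatives of the same covector on
  \<open>SL(3)\<close> differ by multiples of \<open>Q\<^sup>-\<^sup>T\<close>, on which the momentum map does not depend.\<close>
definition cotangent :: "mat3 set \<Rightarrow> (mat3 \<times> mat3) set" where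
  "cotangent Qs = {(Q, P). Q \<in> Qs \<and> P \<in> tangent_space Qs Q}"

text \<open>Minus the exterior derivative of the canonical one-form \<open>P \<bullet> dQ\<close>, evaluated on
  tangent vectors of the cotangent bundle.\<close>
definition symplectic_form :: "mat3 \<times> mat3 \<Rightarrow> mat3 \<times> mat3 \<Rightarrow> real" where
  "symplectic_form v w = fst v \<bullet> snd w - snd v \<bullet> fst w"

text \<open>\<open>X\<close> is the value at \<open>z\<close> of the Hamiltonian vector field of \<open>h\<close>. The derivative \<open>D\<close> within
  the submanifold is determined by \<open>h\<close> on tangent vectors, where it is \<open>dh\<close>.\<close>
definition hamiltonian_vector ::
    "mat3 set \<Rightarrow> (mat3 \<times> mat3 \<Rightarrow> real) \<Rightarrow> mat3 \<times> mat3 \<Rightarrow> mat3 \<times> mat3 \<Rightarrow> bool" where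
  "hamiltonian_vector Qs h z X \<longleftrightarrow>
     X \<in> tangent_space (cotangent Qs) z \<and>
     (\<exists>D. (h has_derivative D) (at z within cotangent Qs) \<and>
          (\<forall>v \<in> tangent_space (cotangent Qs) z. symplectic_form X v = D v))"

definition trajectory ::
    "mat3 set \<Rightarrow> (mat3 \<times> mat3 \<Rightarrow> real) \<Rightarrow> (real \<Rightarrow> mat3 \<times> mat3) \<Rightarrow> bool" where
  "trajectory Qs h c \<longleftrightarrow>
     (\<forall>t. c t \<in> cotangent Qs \<and>
          (\<exists>X. hamiltonian_vector Qs h (c t) X \<and> (c has_vector_derivative X) (at t)))"

section \<open>Symmetry and momentum\<close>

definition G :: "(mat3 \<times> mat3) set" where
  "G = {L. rotation_matrix L} \<times> {R. rotation_matrix R}"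

text \<open>The right factor acts by \<open>R\<^sup>-\<^sup>1 = R\<^sup>T\<close>, so that these are left actions of \<open>G\<close>, and \<open>\<Phi>\<close> below
  is their momentum map, signs included.\<close>
definition conf_act :: "mat3 \<times> mat3 \<Rightarrow> mat3 \<Rightarrow> mat3" where
  "conf_act g Q = fst g ** Q ** transpose (snd g)"

definition cot_act :: "mat3 \<times> mat3 \<Rightarrow> mat3 \<times> mat3 \<Rightarrow> mat3 \<times> mat3" where
  "cot_act g z = (conf_act g (fst z), conf_act g (snd z))"

definition so3 :: "mat3 set" where "so3 = {A. transpose A = - A}"

definition Phi_L :: "mat3 \<times> mat3 \<Rightarrow> mat3" where
  "Phi_L = (\<lambda>(Q, P). (1/2) *\<^sub>R (P ** transpose Q - Q ** transpose P))"

definition Phi_R :: "mat3 \<times> mat3 \<Rightarrow> mat3" where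
  "Phi_R = (\<lambda>(Q, P). (1/2) *\<^sub>R (transpose P ** Q - transpose Q ** P))"

definition Phi :: "mat3 \<times> mat3 \<Rightarrow> mat3 \<times> mat3" where
  "Phi z = (Phi_L z, Phi_R z)"

definition coad :: "mat3 \<times> mat3 \<Rightarrow> mat3 \<times> mat3 \<Rightarrow> mat3 \<times> mat3" where
  "coad g \<mu> = (fst g ** fst \<mu> ** transpose (fst g), snd g ** snd \<mu> ** transpose (snd g))"

definition isotropy :: "mat3 \<times> mat3 \<Rightarrow> (mat3 \<times> mat3) set" where
  "isotropy \<mu> = {g \<in> G. coad g \<mu> = \<mu>}"

definition momentum_level :: "mat3 set \<Rightarrow> mat3 \<times> mat3 \<Rightarrow> (mat3 \<times> mat3) set" where
  "momentum_level Qs \<mu> = {z \<in> cotangent Qs. Phi z = \<mu>}"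

definition reduced_space :: "mat3 set \<Rightarrow> mat3 \<times> mat3 \<Rightarrow> (mat3 \<times> mat3) set topology" where
  "reduced_space Qs \<mu> = orbit_topology cot_act (isotropy \<mu>) (momentum_level Qs \<mu>)"

section \<open>Relative equilibria\<close>

definition relative_equilibrium ::
    "mat3 set \<Rightarrow> (mat3 \<times> mat3 \<Rightarrow> real) \<Rightarrow> (real \<Rightarrow> mat3 \<times> mat3) \<Rightarrow> bool" where
  "relative_equilibrium Qs h c \<longleftrightarrow>
     trajectory Qs h c \<and> (\<exists>Ob. \<forall>t. orbit cot_act G (c t) = Ob)"

definition extremal_relative_equilibrium ::
    "mat3 set \<Rightarrow> (mat3 \<times> mat3 \<Rightarrow> real) \<Rightarrow> mat3 \<times> mat3 \<Rightarrow> (real \<Rightarrow> mat3 \<times> mat3) \<Rightarrow> bool" where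
  "extremal_relative_equilibrium Qs h \<mu> c \<longleftrightarrow>
     relative_equilibrium Qs h c \<and> (\<forall>t. Phi (c t) = \<mu>) \<and>
     (\<forall>t. local_extremum (reduced_space Qs \<mu>) (induced h) (orbit cot_act (isotropy \<mu>) (c t)))"

section \<open>The affine rigid body\<close>

definition pos_def_quadratic_form_on :: "'a::real_vector set \<Rightarrow> ('a \<Rightarrow> real) \<Rightarrow> bool" where
  "pos_def_quadratic_form_on T q \<longleftrightarrow>
     (\<exists>B. bilinear B \<and> (\<forall>p\<in>T. q p = B p p)) \<and> (\<forall>p\<in>T. p \<noteq> 0 \<longrightarrow> q p > 0)"

text \<open>\<open>K (Q, P)\<close> is the kinetic energy, \<open>V Q\<close> the potential energy. The kinetic energy of a
  homogeneous fluid is a positive multiple of \<open>P \<bullet> P\<close>. Differentiability is all that is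
  needed for the Hamiltonian vector field to exist.\<close>
definition affine_rigid_body ::
    "mat3 set \<Rightarrow> (mat3 \<times> mat3 \<Rightarrow> real) \<Rightarrow> (mat3 \<Rightarrow> real) \<Rightarrow> bool" where
  "affine_rigid_body Qs K V \<longleftrightarrow>
     K differentiable_on cotangent Qs \<and>
     (\<forall>Q\<in>Qs. pos_def_quadratic_form_on (tangent_space Qs Q) (\<lambda>P. K (Q, P))) \<and>
     (\<forall>g\<in>G. \<forall>z\<in>cotangent Qs. K (cot_act g z) = K z) \<and>
     V differentiable_on Qs \<and>
     (\<forall>g\<in>G. \<forall>Q\<in>Qs. V (conf_act g Q) = V Q)"

definition hamiltonian ::
    "(mat3 \<times> mat3 \<Rightarrow> real) \<Rightarrow> (mat3 \<Rightarrow> real) \<Rightarrow> mat3 \<times> mat3 \<Rightarrow> real" where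
  "hamiltonian K V z = K z + V (fst z)"

text \<open>A local minimum at \<open>Q\<^sub>0\<close> that is strict among shapes: nearby, the minimal value is only
  attained on the \<open>G\<close>-orbit of \<open>Q\<^sub>0\<close>, where invariance forces it. Strictness cannot be dropped:
  on \<open>GL(3)\<close> with \<open>V = 0\<close> and \<open>K (Q, P) = P \<bullet> P / 2\<close> all trajectories are straight lines
  \<open>Q + t P\<close>, which stay in one orbit only if \<open>P = 0\<close>.\<close>
definition potential_minimum :: "mat3 set \<Rightarrow> (mat3 \<Rightarrow> real) \<Rightarrow> mat3 \<Rightarrow> bool" where
  "potential_minimum Qs V Q\<^sub>0 \<longleftrightarrow>
     (\<forall>\<^sub>F Q in at Q\<^sub>0 within Qs. V Q\<^sub>0 \<le> V Q \<and> (V Q = V Q\<^sub>0 \<longrightarrow> Q \<in> orbit conf_act G Q\<^sub>0))"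

definition is_norm_on :: "'a::real_vector set \<Rightarrow> ('a \<Rightarrow> real) \<Rightarrow> bool" where
  "is_norm_on S N \<longleftrightarrow>
     (\<forall>x\<in>S. 0 \<le> N x \<and> (N x = 0 \<longleftrightarrow> x = 0)) \<and>
     (\<forall>x\<in>S. \<forall>a. N (a *\<^sub>R x) = \<bar>a\<bar> * N x) \<and>
     (\<forall>x\<in>S. \<forall>y\<in>S. N (x + y) \<le> N x + N y)"

end

theory Submission
  imports Defs
begin

text \<open>
  A minimum of the energy \<open>h = K + V\<close> on a momentum level is a relative equilibrium, and small
  momentum levels have such minima near the round configuration at rest.

  The minima are found in \<open>momentum_level_minimum\<close>. Near the identity \<open>V\<close> exceeds \<open>V (mat 1)\<close> away from
  the rotations, and \<open>K\<close> is positive on nonzero covectors. So on the compact boundary of a thin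
  \<open>G\<close>-invariant tube around the rotations at rest, \<open>h\<close> is bounded below by some \<open>m > V (mat 1)\<close>. The
  momentum map is not open at \<open>(mat 1, 0)\<close>, but at an ellipsoid with distinct axes it is a linear
  surjection on covectors; at such an ellipsoid that is nearly round, all small momenta are attained
  inside the tube with energy below \<open>m\<close>. A minimum of \<open>h\<close> over the points of the compact tube with a
  given small momentum is therefore interior.

  At such a minimum \<open>z\<close> the differential of \<open>h\<close> is that of one component of the momentum map
  (\<open>critical_point_on_momentum_level\<close>). If the infinitesimal action is free at \<open>z\<close>, the momentum map is
  a submersion there and this is the Lagrange multiplier rule. Otherwise the momentum level may be
  singular at \<open>z\<close>, as happens for axisymmetric ellipsoids rotating rigidly about their axis, and the
  principle of symmetric criticality takes over: some \<open>(\<xi>, \<eta>) \<noteq> 0\<close> annihilates \<open>z\<close>; on the pairs of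
  matrices that it annihilates the momentum map reduces to a single scalar function, which is regular
  at \<open>z\<close>, and the differential of an invariant function is determined by its values on these pairs. The
  quarter turn in the circle generated by \<open>(\<xi>, \<eta>)\<close> has the same fixed points as the whole circle, so
  an average over four elements projects onto them. The multiplier rule itself is obtained from the
  openness of maps that are continuous and have a surjective derivative at one point, which suits an
  energy that is differentiable but perhaps not continuously so.

  By equivariance, the Hamiltonian vector field along the orbit of \<open>z\<close> under the corresponding
  one-parameter group is the infinitesimal action itself, so that this orbit is a trajectory
  (\<open>relative_equilibrium_one_param\<close>). Noether's theorem keeps its momentum constant; hence it lies in a
  single orbit of the isotropy group and projects to the minimum in the reduced space.

  For \<open>SL(3)\<close> the phase space is not open among pairs of matrices. An equivariant,
  momentum-preserving retraction (\<open>cotangent_retraction\<close>) extends \<open>h\<close> to an open set on which \<open>z\<close> is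
  still a minimum for its momentum.
\<close>


section \<open>The Euclidean space of matrices\<close>

lemma inner_matrix_mult_left:
  fixes A :: "real^'k^'m" and B :: "real^'n^'k"
  shows "(A ** B) \<bullet> C = B \<bullet> (transpose A ** C)"
proof -
  have "(A ** B) \<bullet> C = (\<Sum>i\<in>UNIV. \<Sum>j\<in>UNIV. \<Sum>k\<in>UNIV. A$i$k * B$k$j * C$i$j)"
    by (simp add: inner_vec_def matrix_matrix_mult_def sum_distrib_right)
  also have "\<dots> = (\<Sum>i\<in>UNIV. \<Sum>k\<in>UNIV. \<Sum>j\<in>UNIV. A$i$k * B$k$j * C$i$j)"
    by (intro sum.cong refl) (rule sum.swap)
  also have "\<dots> = (\<Sum>k\<in>UNIV. \<Sum>i\<in>UNIV. \<Sum>j\<in>UNIV. A$i$k * B$k$j * C$i$j)"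
    by (rule sum.swap)
  also have "\<dots> = (\<Sum>k\<in>UNIV. \<Sum>j\<in>UNIV. \<Sum>i\<in>UNIV. A$i$k * B$k$j * C$i$j)"
    by (intro sum.cong refl) (rule sum.swap)
  also have "\<dots> = B \<bullet> (transpose A ** C)"
    by (simp add: inner_vec_def matrix_matrix_mult_def transpose_def sum_distrib_left mult_ac)
  finally show ?thesis .
qed

lemma inner_transpose_transpose:
  fixes A B :: "real^'n^'m"
  shows "transpose A \<bullet> transpose B = A \<bullet> B"
  by (simp add: inner_vec_def transpose_def) (rule sum.swap)

lemma inner_matrix_mult_right:
  fixes A :: "real^'k^'m" and B :: "real^'n^'k"
  shows "(A ** B) \<bullet> C = A \<bullet> (C ** transpose B)"
proof -
  have "(A ** B) \<bullet> C = (transpose B ** transpose A) \<bullet> transpose C"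
    by (metis inner_transpose_transpose matrix_transpose_mul)
  also have "\<dots> = transpose A \<bullet> transpose (C ** transpose B)"
    by (simp add: inner_matrix_mult_left matrix_transpose_mul)
  finally show ?thesis by (simp add: inner_transpose_transpose)
qed

lemma bilinear_matrix_mult: "bilinear ((**) :: real^'k^'m \<Rightarrow> real^'n^'k \<Rightarrow> real^'n^'m)"
  unfolding bilinear_def
  by (auto intro!: linearI simp: vec_eq_iff matrix_matrix_mult_def algebra_simps
      sum.distrib sum_distrib_left)

lemma bounded_bilinear_matrix_mult:
  "bounded_bilinear ((**) :: real^'k^'m \<Rightarrow> real^'n^'k \<Rightarrow> real^'n^'m)"
  using bilinear_matrix_mult by (simp add: bilinear_conv_bounded_bilinear)

lemma linear_transpose: "linear (transpose :: real^'n^'m \<Rightarrow> real^'m^'n)"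
  by (rule linearI) (simp_all add: transpose_def vec_eq_iff)

lemmas matrix_bilinear_simps =
  bounded_bilinear.add_left[OF bounded_bilinear_matrix_mult]
  bounded_bilinear.add_right[OF bounded_bilinear_matrix_mult]
  bounded_bilinear.diff_left[OF bounded_bilinear_matrix_mult]
  bounded_bilinear.diff_right[OF bounded_bilinear_matrix_mult]
  bounded_bilinear.minus_left[OF bounded_bilinear_matrix_mult]
  bounded_bilinear.minus_right[OF bounded_bilinear_matrix_mult]
  bounded_bilinear.zero_left[OF bounded_bilinear_matrix_mult]
  bounded_bilinear.zero_right[OF bounded_bilinear_matrix_mult]
  bounded_bilinear.scaleR_left[OF bounded_bilinear_matrix_mult]
  bounded_bilinear.scaleR_right[OF bounded_bilinear_matrix_mult]

lemmas transpose_simps =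
  linear_add[OF linear_transpose] linear_diff[OF linear_transpose]
  linear_neg[OF linear_transpose] linear_cmul[OF linear_transpose]
  linear_0[OF linear_transpose] matrix_transpose_mul transpose_mat transpose_transpose

lemmas continuous_on_matrix_mult [continuous_intros] =
  bounded_bilinear.continuous_on[OF bounded_bilinear_matrix_mult]

lemmas continuous_on_transpose [continuous_intros] =
  bounded_linear.continuous_on[OF linear_transpose[unfolded linear_conv_bounded_linear]]

lemmas has_derivative_matrix_mult [derivative_intros] =
  bounded_bilinear.FDERIV[OF bounded_bilinear_matrix_mult]

lemmas has_derivative_transpose [derivative_intros] =
  bounded_linear.has_derivative[OF linear_transpose[unfolded linear_conv_bounded_linear]]

lemmas has_vector_derivative_matrix_mult [derivative_intros] =
  bounded_bilinear.has_vector_derivative[OF bounded_bilinear_matrix_mult]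

lemmas has_vector_derivative_transpose [derivative_intros] =
  bounded_linear.has_vector_derivative[OF linear_transpose[unfolded linear_conv_bounded_linear]]

section \<open>Lagrange multipliers\<close>

text \<open>If \<open>(F', f')\<close> were onto, then \<open>(F, f)\<close> would be open at \<open>z\<close> and so would attain the value
  \<open>(F z, f z - e)\<close> near \<open>z\<close>; hence a functional \<open>(y, c)\<close> annihilates its range. Openness needs only
  continuity nearby and a derivative at the single point \<open>z\<close>.\<close>
lemma fritz_john_multiplier:
  fixes f :: "'a::euclidean_space \<Rightarrow> real" and F :: "'a \<Rightarrow> 'b::euclidean_space"
  assumes S: "open S" "z \<in> S" and "continuous_on S f" "continuous_on S F"
    and f': "(f has_derivative f') (at z)" and F': "(F has_derivative F') (at z)"
    and min: "\<And>w. w \<in> S \<Longrightarrow> F w = F z \<Longrightarrow> f z \<le> f w"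
  obtains y c where "(y, c) \<noteq> 0" "\<And>v. y \<bullet> F' v + c * f' v = 0"
proof -
  define T where "T v = (F' v, f' v)" for v
  have der: "((\<lambda>w. (F w, f w)) has_derivative T) (at z)"
    unfolding T_def by (intro derivative_intros f' F')
  then have lin: "linear T" by (simp add: has_derivative_linear)
  have "\<not> surj T"
  proof
    assume "surj T"
    then obtain g where g: "linear g" "T \<circ> g = id"
      using linear_surjective_right_inverse[OF lin] by blast
    have "(F z, f z) \<in> interior ((\<lambda>w. (F w, f w)) ` S)"
      using S by (intro sussmann_open_mapping[OF S(1) _ S(2) der _ g(2)] continuous_on_Pair assms)
        (simp_all add: g linear_linear interior_open)
    then obtain e where e: "e > 0" "ball (F z, f z) e \<subseteq> (\<lambda>w. (F w, f w)) ` S"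
      by (auto simp: mem_interior)
    \<comment> \<open>A value that minimality excludes.\<close>
    have "(F z, f z - e/2) \<in> ball (F z, f z) e"
      using e by (simp add: dist_Pair_Pair dist_real_def)
    then obtain w where "w \<in> S" "F w = F z" "f w = f z - e/2" using e by force
    then show False using min[of w] e by simp
  qed
  then have "span (range T) \<subset> span UNIV"
    using linear_subspace_image[OF lin subspace_UNIV] by (auto simp: span_eq_iff[THEN iffD2])
  then obtain p where p: "p \<noteq> 0" "\<And>y. y \<in> span (range T) \<Longrightarrow> orthogonal p y"
    using orthogonal_to_subspace_exists_gen by blast
  show ?thesis
  proof (rule that)
    show "(fst p, snd p) \<noteq> 0" using p by simp
    fix v
    have "orthogonal p (T v)" by (rule p) (simp add: span_base)
    then show "fst p \<bullet> F' v + snd p * f' v = 0"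
      by (simp add: orthogonal_def T_def inner_prod_def)
  qed
qed

section \<open>Rotations\<close>

lemma mat3_eq_iff:
  fixes A B :: mat3
  shows "A = B \<longleftrightarrow>
    A$1$1 = B$1$1 \<and> A$1$2 = B$1$2 \<and> A$1$3 = B$1$3 \<and>
    A$2$1 = B$2$1 \<and> A$2$2 = B$2$2 \<and> A$2$3 = B$2$3 \<and>
    A$3$1 = B$3$1 \<and> A$3$2 = B$3$2 \<and> A$3$3 = B$3$3"
  by (auto simp: vec_eq_iff forall_3)

lemma matrix_mult_component_3: "(A ** B) $ i $ j = A$i$1 * B$1$j + A$i$2 * B$2$j + A$i$3 * B$3$j"
  for A B :: mat3
  by (simp add: matrix_matrix_mult_def sum_3)

lemma inner_mat3: "A \<bullet> B =
    A$1$1 * B$1$1 + A$1$2 * B$1$2 + A$1$3 * B$1$3 +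
    A$2$1 * B$2$1 + A$2$2 * B$2$2 + A$2$3 * B$2$3 +
    A$3$1 * B$3$1 + A$3$2 * B$3$2 + A$3$3 * B$3$3" for A B :: mat3
  by (simp add: inner_vec_def sum_3)

lemma so3_transpose: "A \<in> so3 \<Longrightarrow> transpose A = - A"
  by (simp add: so3_def)

lemma subspace_so3: "subspace so3"
  by (auto simp: subspace_def so3_def transpose_simps)

lemma so3_components:
  assumes "A \<in> so3"
  shows "A$1$1 = 0" "A$2$2 = 0" "A$3$3 = 0" "A$2$1 = - A$1$2" "A$3$1 = - A$1$3" "A$3$2 = - A$2$3"
proof -
  have "A$i$j = - A$j$i" for i j
  proof -
    have "transpose A $ j $ i = (- A) $ j $ i" using so3_transpose[OF assms] by simp
    then show ?thesis by (simp add: transpose_def)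
  qed
  from this[of 1 1] this[of 2 2] this[of 3 3] this[of 2 1] this[of 3 1] this[of 3 2]
  show "A$1$1 = 0" "A$2$2 = 0" "A$3$3 = 0" "A$2$1 = - A$1$2" "A$3$1 = - A$1$3" "A$3$2 = - A$2$3"
    by linarith+
qed

text \<open>The Cayley-Hamilton identity of a skew-symmetric matrix.\<close>
lemma so3_cube:
  assumes "A \<in> so3"
  shows "A ** (A ** A) = - ((A \<bullet> A / 2) *\<^sub>R A)"
  by (simp add: mat3_eq_iff matrix_mult_component_3 inner_mat3 so3_components[OF assms] field_simps)

text \<open>The commutator of skew-symmetric matrices is the cross product of their axes.\<close>
lemma so3_commute_parallel:
  assumes A: "A \<in> so3" and B: "B \<in> so3" and c: "A ** B = B ** A"
  shows "(A \<bullet> A) *\<^sub>R B = (A \<bullet> B) *\<^sub>R A"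
proof -
  define a b p q r s where "a = A$1$2" and "b = A$1$3" and "p = A$2$3"
    and "q = B$1$2" and "r = B$1$3" and "s = B$2$3"
  note defs = a_def b_def p_def q_def r_def s_def
  have "(A ** B) $ 1 $ 2 = (B ** A) $ 1 $ 2" "(A ** B) $ 1 $ 3 = (B ** A) $ 1 $ 3"
    "(A ** B) $ 2 $ 3 = (B ** A) $ 2 $ 3" using c by simp_all
  then have "b * s = r * p" "a * s = q * p" "a * r = q * b"
    by (simp_all add: matrix_mult_component_3 so3_components[OF A] so3_components[OF B] flip: defs)
  then show ?thesis
    unfolding mat3_eq_iff inner_mat3 vector_scaleR_component real_scaleR_def
      so3_components[OF A] so3_components[OF B] defs[symmetric]
    by (intro conjI; (algebra | simp))
qed

text \<open>Rodrigues' formula for the one-parameter group with generator \<open>A\<close>. For \<open>A = 0\<close> the quotients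
  are \<open>0\<close> and the formula gives the identity, as it should.\<close>
definition rot :: "mat3 \<Rightarrow> real \<Rightarrow> mat3" where
  "rot A t = (let k = sqrt (A \<bullet> A / 2) in
     mat 1 + (sin (k * t) / k) *\<^sub>R A + ((1 - cos (k * t)) / k\<^sup>2) *\<^sub>R (A ** A))"

lemma rot_zero [simp]: "rot A 0 = mat 1"
  by (simp add: rot_def Let_def)

lemma rot_of_zero [simp]: "rot 0 t = mat 1"
  by (simp add: rot_def Let_def matrix_bilinear_simps)

lemma so3_rate: "A \<noteq> 0 \<Longrightarrow> sqrt (A \<bullet> A / 2) > 0" "(sqrt (A \<bullet> A / 2))\<^sup>2 = A \<bullet> A / 2" for A :: mat3
  by auto

lemma so3_fourth:
  assumes "A \<in> so3"
  shows "(A ** A) ** (A ** A) = - ((A \<bullet> A / 2) *\<^sub>R (A ** A))"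
  by (metis matrix_mul_assoc so3_cube[OF assms] bounded_bilinear.minus_right[OF bounded_bilinear_matrix_mult]
     bounded_bilinear.scaleR_right[OF bounded_bilinear_matrix_mult])

lemma rot_has_vector_derivative:
  assumes A: "A \<in> so3"
  shows "(rot A has_vector_derivative A ** rot A t) (at t within T)"
proof (cases "A = 0")
  case True
  have "rot 0 = (\<lambda>t. mat 1)" by (rule ext) simp
  then show ?thesis using True by (simp add: matrix_bilinear_simps)
next
  case False
  define k where "k = sqrt (A \<bullet> A / 2)"
  have k: "k > 0" "A \<bullet> A / 2 = k\<^sup>2"
    using so3_rate[of A] False by (auto simp: k_def)
  have rot: "rot A = (\<lambda>t. mat 1 + (sin (k * t) / k) *\<^sub>R A + ((1 - cos (k * t)) / k\<^sup>2) *\<^sub>R (A ** A))"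
    by (rule ext) (simp add: rot_def k_def Let_def)
  have s: "((\<lambda>t. sin (k * t) / k) has_real_derivative cos (k * t)) (at t within T)"
    using k by (auto intro!: derivative_eq_intros)
  have c: "((\<lambda>t. (1 - cos (k * t)) / k\<^sup>2) has_real_derivative sin (k * t) / k) (at t within T)"
    using k by (auto intro!: derivative_eq_intros simp: power2_eq_square)
  have "(rot A has_vector_derivative cos (k * t) *\<^sub>R A + (sin (k * t) / k) *\<^sub>R (A ** A)) (at t within T)"
    unfolding rot by (rule has_vector_derivative_eq_rhs, (rule derivative_intros s c)+) simp
  also have "cos (k * t) *\<^sub>R A + (sin (k * t) / k) *\<^sub>R (A ** A) = A ** rot A t"
  proof -
    have "A ** rot A t = A + (sin (k * t) / k) *\<^sub>R (A ** A) - (((1 - cos (k * t)) / k\<^sup>2) * k\<^sup>2) *\<^sub>R A"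
      unfolding rot by (simp add: matrix_bilinear_simps so3_cube[OF A] k(2))
    also have "((1 - cos (k * t)) / k\<^sup>2) * k\<^sup>2 = 1 - cos (k * t)" using k by simp
    finally show ?thesis by (simp add: scaleR_diff_left)
  qed
  finally show ?thesis .
qed

text \<open>Doubling is all of the group law that is used: it settles the sign of the determinant and the order
  of the quarter turn.\<close>
lemma rot_double:
  assumes A: "A \<in> so3"
  shows "rot A (2 * t) = rot A t ** rot A t"
proof (cases "A = 0")
  case False
  define k where "k = sqrt (A \<bullet> A / 2)"
  define a b where "a = sin (k * t) / k" and "b = (1 - cos (k * t)) / k\<^sup>2"
  have k: "k > 0" "A \<bullet> A / 2 = k\<^sup>2"
    using so3_rate[of A] False by (auto simp: k_def)
  have c: "cos (k * t) = 1 - k\<^sup>2 * b" and s: "sin (k * t) = k * a"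
    using k by (simp_all add: a_def b_def)
  have eq: "2 * b - a\<^sup>2 - k\<^sup>2 * b\<^sup>2 = 0"
  proof -
    have "k\<^sup>2 * (2 * b - a\<^sup>2 - k\<^sup>2 * b\<^sup>2) = 0"
      using sin_cos_squared_add[of "k * t"] unfolding c s by algebra
    then show ?thesis using k by simp
  qed
  have "sin (k * (2 * t)) / k = 2 * a - 2 * a * b * k\<^sup>2"
    using sin_double[of "k * t"] k by (simp add: c s field_simps)
  moreover have "(1 - cos (k * (2 * t))) / k\<^sup>2 = 2 * a\<^sup>2"
  proof -
    have "1 - cos (k * (2 * t)) = 2 * (k * a)\<^sup>2"
      using cos_double_sin[of "k * t"] by (simp add: s mult_ac)
    then show ?thesis using k by (simp add: power_mult_distrib)
  qed
  ultimately have "rot A (2 * t) = mat 1 + (2 * a - 2 * a * b * k\<^sup>2) *\<^sub>R A + (2 * a\<^sup>2) *\<^sub>R (A ** A)"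
    unfolding rot_def Let_def k_def[symmetric] by simp
  also have "2 * a\<^sup>2 = 2 * b + a\<^sup>2 - k\<^sup>2 * b\<^sup>2" using eq by simp
  also have "mat 1 + (2 * a - 2 * a * b * k\<^sup>2) *\<^sub>R A + (2 * b + a\<^sup>2 - k\<^sup>2 * b\<^sup>2) *\<^sub>R (A ** A)
      = (mat 1 + a *\<^sub>R A + b *\<^sub>R (A ** A)) ** (mat 1 + a *\<^sub>R A + b *\<^sub>R (A ** A))"
    by (simp add: matrix_bilinear_simps so3_cube[OF A] so3_fourth[OF A] k(2) flip: matrix_mul_assoc)
       (simp add: vec_eq_iff algebra_simps power2_eq_square)
  also have "mat 1 + a *\<^sub>R A + b *\<^sub>R (A ** A) = rot A t"
    by (simp add: rot_def Let_def k_def a_def b_def)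
  finally show ?thesis .
qed simp

lemma rot_orthogonal:
  assumes A: "A \<in> so3"
  shows "transpose (rot A t) ** rot A t = mat 1"
proof -
  have "((\<lambda>t. transpose (rot A t) ** rot A t) has_vector_derivative 0) (at t)" for t
    by (auto intro!: derivative_eq_intros rot_has_vector_derivative[OF A]
        simp: transpose_simps so3_transpose[OF A] matrix_bilinear_simps matrix_mul_assoc)
  then have "(\<lambda>t. transpose (rot A t) ** rot A t) t = (\<lambda>t. transpose (rot A t) ** rot A t) 0"
    by (intro has_derivative_zero_unique_connected[of UNIV]) (auto simp: has_vector_derivative_def)
  then show ?thesis by (simp add: transpose_simps)
qed

text \<open>The determinant is \<open>1\<close> rather than \<open>-1\<close> because every \<open>rot A t\<close> is a square.\<close>
lemma rotation_matrix_rot: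
  assumes A: "A \<in> so3"
  shows "rotation_matrix (rot A t)"
proof -
  have o: "orthogonal_matrix (rot A s)" for s
    by (simp add: orthogonal_matrix rot_orthogonal[OF A])
  have "det (rot A t) = (det (rot A (t/2)))\<^sup>2"
    using rot_double[OF A, of "t/2"] by (simp add: det_mul power2_eq_square)
  moreover have "det (rot A (t/2)) = 1 \<or> det (rot A (t/2)) = - 1"
    by (rule det_orthogonal_matrix[OF o])
  ultimately show ?thesis using o by (auto simp: rotation_matrix_def)
qed

section \<open>The action of \<open>SO(3) \<times> SO(3)\<close>\<close>

lemma rotation_matrixD:
  assumes "rotation_matrix L"
  shows "transpose L ** L = mat 1" "L ** transpose L = mat 1" "det L = 1"
    "transpose L ** (L ** A) = A" "L ** (transpose L ** A) = A"
    "(A ** L) ** transpose L = A" "(A ** transpose L) ** L = A"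
  using assms by (simp_all add: rotation_matrix_def orthogonal_matrix_def matrix_mul_assoc[symmetric])
    (simp_all add: matrix_mul_assoc)

lemma G_iff: "g \<in> G \<longleftrightarrow> rotation_matrix (fst g) \<and> rotation_matrix (snd g)"
  by (auto simp: G_def mem_Times_iff)

lemma rotation_matrix_transpose: "rotation_matrix L \<Longrightarrow> rotation_matrix (transpose L)"
  by (simp add: rotation_matrix_def det_transpose)

lemma rotation_matrix_mult: "rotation_matrix L \<Longrightarrow> rotation_matrix M \<Longrightarrow> rotation_matrix (L ** M)"
  for L M :: mat3
  by (simp add: rotation_matrix_def det_mul orthogonal_matrix_mul)

definition G_inv :: "mat3 \<times> mat3 \<Rightarrow> mat3 \<times> mat3" where
  "G_inv g = (transpose (fst g), transpose (snd g))"

lemma G_inv_mem: "g \<in> G \<Longrightarrow> G_inv g \<in> G"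
  by (simp add: G_iff G_inv_def rotation_matrix_transpose)

lemma linear_conf_act: "linear (conf_act g)"
  by (rule linearI) (simp_all add: conf_act_def matrix_bilinear_simps)

lemma linear_cot_act: "linear (cot_act g)"
  by (rule linearI) (simp_all add: cot_act_def linear_add[OF linear_conf_act] linear_cmul[OF linear_conf_act])

lemma conf_act_inv:
  assumes "g \<in> G"
  shows "conf_act (G_inv g) (conf_act g A) = A" "conf_act g (conf_act (G_inv g) A) = A"
  using assms by (simp_all add: G_iff conf_act_def G_inv_def rotation_matrixD matrix_mul_assoc[symmetric])

lemma cot_act_inv:
  assumes "g \<in> G"
  shows "cot_act (G_inv g) (cot_act g z) = z" "cot_act g (cot_act (G_inv g) z) = z"
  using assms by (simp_all add: cot_act_def conf_act_inv)

lemma conf_act_inner: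
  assumes "g \<in> G"
  shows "conf_act g A \<bullet> conf_act g B = A \<bullet> B"
proof -
  have "conf_act g A \<bullet> conf_act g B = (fst g ** A) \<bullet> (conf_act g B ** snd g)"
    by (simp add: conf_act_def inner_matrix_mult_right[of _ "transpose (snd g)"] transpose_simps)
  also have "\<dots> = A \<bullet> (transpose (fst g) ** (conf_act g B ** snd g))"
    by (rule inner_matrix_mult_left)
  also have "transpose (fst g) ** (conf_act g B ** snd g) = conf_act (G_inv g) (conf_act g B)"
    by (simp add: conf_act_def G_inv_def transpose_simps matrix_mul_assoc)
  finally show ?thesis by (simp add: conf_act_inv assms)
qed

lemma norm_conf_act: "g \<in> G \<Longrightarrow> norm (conf_act g A) = norm A"
  by (simp add: norm_eq_sqrt_inner conf_act_inner)

definition inf_act :: "mat3 \<times> mat3 \<Rightarrow> mat3 \<Rightarrow> mat3" where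
  "inf_act \<zeta> A = fst \<zeta> ** A - A ** snd \<zeta>"

definition inf_cot_act :: "mat3 \<times> mat3 \<Rightarrow> mat3 \<times> mat3 \<Rightarrow> mat3 \<times> mat3" where
  "inf_cot_act \<zeta> z = (inf_act \<zeta> (fst z), inf_act \<zeta> (snd z))"

text \<open>The pairing of the momentum map with \<open>\<zeta>\<close>, by \<open>momentum_eq_Phi\<close>: as for every cotangent lift, the
  covector applied to the infinitesimal action on configurations.\<close>
definition momentum :: "mat3 \<times> mat3 \<Rightarrow> mat3 \<times> mat3 \<Rightarrow> real" where
  "momentum \<zeta> z = snd z \<bullet> inf_act \<zeta> (fst z)"

definition one_param :: "mat3 \<times> mat3 \<Rightarrow> real \<Rightarrow> mat3 \<times> mat3" where
  "one_param \<zeta> t = (rot (fst \<zeta>) t, rot (snd \<zeta>) t)"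

lemma one_param_mem: "\<zeta> \<in> so3 \<times> so3 \<Longrightarrow> one_param \<zeta> t \<in> G"
  by (auto simp: G_iff one_param_def rotation_matrix_rot)

lemma cot_act_one_param_zero [simp]: "cot_act (one_param \<zeta> 0) z = z"
  by (simp add: cot_act_def conf_act_def one_param_def transpose_simps)

lemma linear_inf_act: "linear (inf_act \<zeta>)"
  by (rule linearI) (simp_all add: inf_act_def matrix_bilinear_simps algebra_simps)

lemma cot_act_one_param_derivative:
  assumes "\<zeta> \<in> so3 \<times> so3"
  shows "((\<lambda>t. cot_act (one_param \<zeta> t) z) has_vector_derivative
           inf_cot_act \<zeta> (cot_act (one_param \<zeta> t) z)) (at t)"
proof -
  have \<zeta>: "fst \<zeta> \<in> so3" "snd \<zeta> \<in> so3" using assms by auto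
  have "((\<lambda>t. conf_act (one_param \<zeta> t) A) has_vector_derivative
           inf_act \<zeta> (conf_act (one_param \<zeta> t) A)) (at t)" for A
    unfolding conf_act_def one_param_def inf_act_def
    by (auto intro!: derivative_eq_intros rot_has_vector_derivative[OF \<zeta>(1)] rot_has_vector_derivative[OF \<zeta>(2)]
        simp: transpose_simps so3_transpose[OF \<zeta>(2)] matrix_bilinear_simps matrix_mul_assoc)
  then show ?thesis
    unfolding cot_act_def inf_cot_act_def by (auto intro!: has_vector_derivative_Pair)
qed

lemma inf_act_skew:
  assumes "\<zeta> \<in> so3 \<times> so3"
  shows "inf_act \<zeta> A \<bullet> B = - (A \<bullet> inf_act \<zeta> B)"
  using assms unfolding inf_act_def
  by (auto simp: inner_diff_left inner_diff_right inner_matrix_mult_left[of "fst \<zeta>"] inner_matrix_mult_right[of _ "snd \<zeta>"]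
      so3_transpose matrix_bilinear_simps)

text \<open>That is, \<open>inf_cot_act \<zeta>\<close> is the Hamiltonian vector field of \<open>momentum \<zeta>\<close>.\<close>
lemma momentum_has_derivative:
  assumes "\<zeta> \<in> so3 \<times> so3"
  shows "(momentum \<zeta> has_derivative symplectic_form (inf_cot_act \<zeta> z)) (at z)"
proof -
  have "((\<lambda>z. snd z \<bullet> inf_act \<zeta> (fst z)) has_derivative
      (\<lambda>v. snd z \<bullet> inf_act \<zeta> (fst v) + snd v \<bullet> inf_act \<zeta> (fst z))) (at z)"
    by (intro derivative_intros bounded_linear.has_derivative[OF linear_inf_act[unfolded linear_conv_bounded_linear]])
  also have "(\<lambda>v. snd z \<bullet> inf_act \<zeta> (fst v) + snd v \<bullet> inf_act \<zeta> (fst z)) = symplectic_form (inf_cot_act \<zeta> z)"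
    using inf_act_skew[OF assms, of "snd z"]
    by (intro ext) (simp add: symplectic_form_def inf_cot_act_def inner_commute[of "snd v" for v])
  finally show ?thesis by (simp add: momentum_def[abs_def])
qed

lemma Phi_mem_so3: "Phi_L z \<in> so3" "Phi_R z \<in> so3"
  by (auto simp: Phi_L_def Phi_R_def so3_def transpose_simps split: prod.splits simp flip: scaleR_minus_right)

lemma so3_inner_transpose: "A \<in> so3 \<Longrightarrow> A \<bullet> transpose B = - (A \<bullet> B)"
  by (metis inner_minus_left inner_transpose_transpose so3_transpose transpose_transpose)

lemma momentum_eq_Phi:
  assumes "\<zeta> \<in> so3 \<times> so3"
  shows "momentum \<zeta> z = fst \<zeta> \<bullet> Phi_L z + snd \<zeta> \<bullet> Phi_R z"
proof -
  obtain \<xi> \<eta> Q P where [simp]: "\<zeta> = (\<xi>, \<eta>)" "z = (Q, P)" by (metis surj_pair)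
  have \<xi>: "\<xi> \<in> so3" and \<eta>: "\<eta> \<in> so3" using assms by auto
  have "\<xi> \<bullet> Phi_L z = \<xi> \<bullet> (P ** transpose Q)"
    using so3_inner_transpose[OF \<xi>, of "P ** transpose Q"]
    by (simp add: Phi_L_def inner_diff_right transpose_simps)
  also have "\<dots> = P \<bullet> (\<xi> ** Q)"
    by (simp add: inner_commute[of P] inner_matrix_mult_right)
  finally have L: "\<xi> \<bullet> Phi_L z = P \<bullet> (\<xi> ** Q)" .
  have "\<eta> \<bullet> Phi_R z = - (\<eta> \<bullet> (transpose Q ** P))"
    using so3_inner_transpose[OF \<eta>, of "transpose Q ** P"]
    by (simp add: Phi_R_def inner_diff_right transpose_simps)
  also have "\<dots> = - (P \<bullet> (Q ** \<eta>))"
    by (simp add: inner_commute[of P] inner_matrix_mult_left)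
  finally show ?thesis using L
    by (simp add: momentum_def inf_act_def inner_diff_right)
qed

lemma so3_eqI:
  assumes "A \<in> so3" "B \<in> so3" and "\<And>\<xi>. \<xi> \<in> so3 \<Longrightarrow> \<xi> \<bullet> A = \<xi> \<bullet> B"
  shows "A = B"
proof -
  have "A - B \<in> so3" using assms subspace_so3 by (simp add: subspace_diff)
  then have "(A - B) \<bullet> (A - B) = 0" using assms(3)[of "A - B"] by (simp add: inner_diff_right)
  then show ?thesis by simp
qed

lemma Phi_eqI:
  assumes "\<And>\<zeta>. \<zeta> \<in> so3 \<times> so3 \<Longrightarrow> momentum \<zeta> z = momentum \<zeta> w"
  shows "Phi z = Phi w"
proof -
  have 0: "0 \<in> so3" using subspace_so3 subspace_0 by blast
  have "Phi_L z = Phi_L w"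
    using assms 0 by (intro so3_eqI Phi_mem_so3) (metis SigmaI momentum_eq_Phi fst_conv snd_conv inner_zero_left add.right_neutral)
  moreover have "Phi_R z = Phi_R w"
    using assms 0 by (intro so3_eqI Phi_mem_so3) (metis SigmaI momentum_eq_Phi fst_conv snd_conv inner_zero_left add.left_neutral)
  ultimately show ?thesis by (simp add: Phi_def)
qed

lemma Phi_equivariant:
  assumes "g \<in> G"
  shows "Phi (cot_act g z) = coad g (Phi z)"
  using assms by (auto simp: Phi_def Phi_L_def Phi_R_def cot_act_def conf_act_def coad_def G_iff transpose_simps
      matrix_bilinear_simps matrix_mul_assoc rotation_matrixD split: prod.splits)

section \<open>Symmetric criticality\<close>

lemma so3_symmetric_eq_0:
  assumes "A \<in> so3" "transpose A = A"
  shows "A = 0"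
proof -
  have "A = - A" using assms by (simp add: so3_def)
  then show ?thesis by (metis (no_types) eq_neg_iff_add_eq_0 scaleR_2 scaleR_eq_0_iff zero_neq_numeral)
qed

lemma symplectic_form_cot_act:
  "g \<in> G \<Longrightarrow> symplectic_form (cot_act g v) (cot_act g w) = symplectic_form v w"
  by (simp add: symplectic_form_def cot_act_def conf_act_inner)

lemma bounded_linear_cot_act: "bounded_linear (cot_act g)"
  using linear_cot_act by (simp add: linear_conv_bounded_linear)

lemma Phi_has_derivative:
  obtains Phi' where "(Phi has_derivative Phi') (at z)"
    "\<And>\<zeta> v. \<zeta> \<in> so3 \<times> so3 \<Longrightarrow> \<zeta> \<bullet> Phi' v = symplectic_form (inf_cot_act \<zeta> z) v"
proof -
  have Phi: "Phi = (\<lambda>z. ((1/2) *\<^sub>R (snd z ** transpose (fst z) - fst z ** transpose (snd z)),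
      (1/2) *\<^sub>R (transpose (snd z) ** fst z - transpose (fst z) ** snd z)))"
    by (rule ext) (simp add: Phi_def Phi_L_def Phi_R_def case_prod_unfold)
  have "\<exists>Phi'. (Phi has_derivative Phi') (at z)"
    unfolding Phi by (rule exI) (rule derivative_intros)+
  then obtain Phi' where Phi': "(Phi has_derivative Phi') (at z)" by blast
  show ?thesis
  proof (rule that[OF Phi'])
    fix \<zeta> v assume \<zeta>: "\<zeta> \<in> so3 \<times> so3"
    have "momentum \<zeta> = (\<lambda>z. \<zeta> \<bullet> Phi z)"
      by (rule ext) (simp add: momentum_eq_Phi[OF \<zeta>] inner_prod_def Phi_def)
    then have "(momentum \<zeta> has_derivative (\<lambda>v. \<zeta> \<bullet> Phi' v)) (at z)"
      by (auto intro: derivative_intros Phi')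
    then have "(\<lambda>v. \<zeta> \<bullet> Phi' v) = symplectic_form (inf_cot_act \<zeta> z)"
      using momentum_has_derivative[OF \<zeta>] has_derivative_unique by blast
    then show "\<zeta> \<bullet> Phi' v = symplectic_form (inf_cot_act \<zeta> z) v"
      by (rule fun_cong)
  qed
qed

lemma symplectic_form_nondegenerate:
  assumes "\<And>v. symplectic_form X v = 0"
  shows "X = 0"
  using assms[of "(0, fst X)"] assms[of "(snd X, 0)"]
  by (simp add: symplectic_form_def prod_eq_iff)

text \<open>The multiplier rule cannot fail when the isotropy algebra of \<open>z\<close> is trivial, since then the
  derivative of the momentum map is onto. Symmetric matrices are added to the values of the momentum
  map to make its target a full Euclidean space; they force the multiplier to be skew-symmetric.\<close>
lemma critical_point_free:
  assumes S: "open S" "z \<in> S" and cont: "continuous_on S f" and D: "(f has_derivative D) (at z)"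
    and min: "\<And>w. w \<in> S \<Longrightarrow> Phi w = Phi z \<Longrightarrow> f z \<le> f w"
    and free: "\<And>\<zeta>. \<zeta> \<in> so3 \<times> so3 \<Longrightarrow> inf_cot_act \<zeta> z = 0 \<Longrightarrow> \<zeta> = 0"
  obtains \<zeta> where "\<zeta> \<in> so3 \<times> so3" "\<And>v. D v = symplectic_form (inf_cot_act \<zeta> z) v"
proof -
  obtain Phi' where Phi': "(Phi has_derivative Phi') (at z)"
    and Phi'_eq: "\<And>\<zeta> v. \<zeta> \<in> so3 \<times> so3 \<Longrightarrow> \<zeta> \<bullet> Phi' v = symplectic_form (inf_cot_act \<zeta> z) v"
    using Phi_has_derivative by blast
  define sym :: "mat3 \<times> mat3 \<Rightarrow> mat3 \<times> mat3" where
    "sym u = (fst u + transpose (fst u), snd u + transpose (snd u))" for u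
  have "linear sym"
    by (rule linearI) (simp_all add: sym_def transpose_simps algebra_simps)
  then have blin: "bounded_linear sym" by (simp add: linear_conv_bounded_linear)
  have Phi_cont: "continuous_on UNIV Phi"
    using Phi_has_derivative has_derivative_continuous by (metis continuous_at_imp_continuous_on)
  define F where "F p = Phi (fst p) + sym (snd p)" for p :: "(mat3 \<times> mat3) \<times> (mat3 \<times> mat3)"
  have dF: "(F has_derivative (\<lambda>p. Phi' (fst p) + sym (snd p))) (at (z, 0))"
    unfolding F_def
    by (intro derivative_intros has_derivative_compose[of fst fst _ _ Phi Phi', simplified o_def]
        bounded_linear.has_derivative[OF blin]) (simp add: Phi')
  have df: "((\<lambda>p. f (fst p)) has_derivative (\<lambda>p. D (fst p))) (at (z, 0 :: mat3 \<times> mat3))"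
    by (rule has_derivative_compose[of fst fst]) (auto intro: derivative_intros D)
  have minF: "f (fst (z, 0 :: mat3 \<times> mat3)) \<le> f (fst p)" if "p \<in> S \<times> UNIV" "F p = F (z, 0)" for p
  proof -
    have eq: "Phi (fst p) - Phi z = - sym (snd p)"
      using that(2) linear_0[OF \<open>linear sym\<close>] by (simp add: F_def algebra_simps)
    have "fst (Phi (fst p) - Phi z) \<in> so3" "snd (Phi (fst p) - Phi z) \<in> so3"
      using Phi_mem_so3 subspace_so3 by (auto simp: Phi_def subspace_diff)
    then have "fst (sym (snd p)) \<in> so3" "snd (sym (snd p)) \<in> so3"
      unfolding eq using subspace_so3 subspace_neg by fastforce+
    then have "sym (snd p) = 0"
      by (auto simp: sym_def transpose_simps prod_eq_iff add.commute intro!: so3_symmetric_eq_0)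
    then show ?thesis using eq that(1) by (auto intro!: min)
  qed
  have contF: "continuous_on (S \<times> UNIV) F"
    unfolding F_def by (intro continuous_intros continuous_on_compose2[OF Phi_cont]
        bounded_linear.continuous_on[OF blin]) auto
  have contf: "continuous_on (S \<times> (UNIV :: (mat3 \<times> mat3) set)) (\<lambda>p. f (fst p))"
    by (rule continuous_on_compose2[OF cont]) (auto intro: continuous_intros)
  obtain y c where yc: "(y, c) \<noteq> 0"
    "\<And>p. y \<bullet> (Phi' (fst p) + sym (snd p)) + c * D (fst p) = 0"
    by (rule fritz_john_multiplier[OF open_Times[OF S(1) open_UNIV] _ contf contF df dF minF])
       (use S in auto)
  have 0: "Phi' 0 = 0" "D 0 = 0"
    using linear_0 Phi' D has_derivative_linear by blast+
  \<comment> \<open>The multiplier is orthogonal to the range of \<open>sym\<close>.\<close>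
  have "y \<in> so3 \<times> so3"
  proof -
    have "y \<bullet> sym u = sym y \<bullet> u" for u
      using inner_transpose_transpose[of "fst y" "transpose (fst u)"]
        inner_transpose_transpose[of "snd y" "transpose (snd u)"]
      by (simp add: sym_def inner_prod_def inner_add_left inner_add_right transpose_simps)
    then have "sym y \<bullet> u = 0" for u using yc(2)[of "(0, u)"] by (simp add: 0)
    from this[of "sym y"] have "sym y = 0" by simp
    then show ?thesis by (simp add: sym_def so3_def mem_Times_iff prod_eq_iff eq_neg_iff_add_eq_0 add.commute)
  qed
  have yD: "symplectic_form (inf_cot_act y z) v + c * D v = 0" for v
    using yc(2)[of "(v, 0)"] Phi'_eq[OF \<open>y \<in> so3 \<times> so3\<close>] linear_0[OF \<open>linear sym\<close>] by simp
  have "c \<noteq> 0"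
  proof
    assume "c = 0"
    then have "inf_cot_act y z = 0" using yD symplectic_form_nondegenerate by simp
    with free[OF \<open>y \<in> so3 \<times> so3\<close>] yc(1) \<open>c = 0\<close> show False by (simp add: zero_prod_def)
  qed
  have scale: "inf_cot_act (a *\<^sub>R \<zeta>) z = a *\<^sub>R inf_cot_act \<zeta> z" for a \<zeta>
    by (simp add: inf_cot_act_def inf_act_def matrix_bilinear_simps scaleR_diff_right)
  show ?thesis
  proof (rule that[of "(- 1 / c) *\<^sub>R y"])
    show "(- 1 / c) *\<^sub>R y \<in> so3 \<times> so3"
      using \<open>y \<in> so3 \<times> so3\<close> subspace_so3 by (auto simp: subspace_scale subspace_neg)
    fix v
    show "D v = symplectic_form (inf_cot_act ((- 1 / c) *\<^sub>R y) z) v"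
      using yD[of v] \<open>c \<noteq> 0\<close> unfolding scale
      by (simp add: symplectic_form_def field_simps)
  qed
qed

lemma inf_act_zero_iff: "inf_act \<zeta> M = 0 \<longleftrightarrow> fst \<zeta> ** M = M ** snd \<zeta>"
  by (simp add: inf_act_def)

text \<open>Matrices fixed by an infinitesimal rotation \<open>\<zeta>\<close> of rate \<open>k\<close> are those fixed by the quarter turn
  that it generates, because the quarter turn minus its inverse is \<open>2 \<zeta> / k\<close>.\<close>
lemma quarter_turn:
  assumes \<zeta>: "\<zeta> \<in> so3 \<times> so3"
    and k: "k > 0" "fst \<zeta> \<bullet> fst \<zeta> / 2 = k\<^sup>2" "snd \<zeta> \<bullet> snd \<zeta> / 2 = k\<^sup>2"
  defines "g \<equiv> one_param \<zeta> (pi / 2 / k)"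
  shows "conf_act g M = M \<longleftrightarrow> inf_act \<zeta> M = 0"
    and "conf_act g (conf_act g (conf_act g (conf_act g M))) = M"
proof -
  have \<xi>: "fst \<zeta> \<in> so3" and \<eta>: "snd \<zeta> \<in> so3" using \<zeta> by auto
  have turn: "rot A (pi / 2 / k) = mat 1 + (1 / k) *\<^sub>R A + (1 / k\<^sup>2) *\<^sub>R (A ** A)"
    "rot A (pi / 2 / k) - transpose (rot A (pi / 2 / k)) = (2 / k) *\<^sub>R A"
    "rot A (2 * (2 * (pi / 2 / k))) = mat 1"
    if "A \<in> so3" "A \<bullet> A / 2 = k\<^sup>2" for A
  proof -
    have s: "sqrt (A \<bullet> A / 2) = k" using k(1) that(2) by (simp add: real_sqrt_unique)
    show t: "rot A (pi / 2 / k) = mat 1 + (1 / k) *\<^sub>R A + (1 / k\<^sup>2) *\<^sub>R (A ** A)"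
      unfolding rot_def s Let_def using k(1) by simp
    show "rot A (pi / 2 / k) - transpose (rot A (pi / 2 / k)) = (2 / k) *\<^sub>R A"
      unfolding t by (simp add: transpose_simps so3_transpose[OF that(1)] matrix_bilinear_simps
         flip: scaleR_add_left)
    show "rot A (2 * (2 * (pi / 2 / k))) = mat 1"
      unfolding rot_def s Let_def using k(1) by simp
  qed
  note L = turn[OF \<xi> k(2)] and R = turn[OF \<eta> k(3)]
  have g: "g \<in> G" by (simp add: g_def one_param_mem \<zeta>)
  show "conf_act g M = M \<longleftrightarrow> inf_act \<zeta> M = 0"
  proof
    assume *: "conf_act g M = M"
    then have 1: "fst g ** M = M ** snd g"
      using g by (metis G_iff conf_act_def rotation_matrixD(7))
    have "conf_act (G_inv g) M = M" using * g conf_act_inv by metis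
    then have 2: "transpose (fst g) ** M = M ** transpose (snd g)"
      using g by (metis G_iff G_inv_def conf_act_def fst_conv snd_conv transpose_transpose rotation_matrixD(6))
    have "(fst g - transpose (fst g)) ** M = M ** (snd g - transpose (snd g))"
      using 1 2 by (simp add: matrix_bilinear_simps)
    then have "((2 / k) *\<^sub>R fst \<zeta>) ** M = M ** ((2 / k) *\<^sub>R snd \<zeta>)"
      by (simp only: g_def one_param_def fst_conv snd_conv L(2) R(2))
    then show "inf_act \<zeta> M = 0"
      using k(1) by (simp add: matrix_bilinear_simps inf_act_zero_iff)
  next
    assume "inf_act \<zeta> M = 0"
    then have c: "fst \<zeta> ** M = M ** snd \<zeta>" by (simp add: inf_act_zero_iff)
    then have "(fst \<zeta> ** fst \<zeta>) ** M = M ** (snd \<zeta> ** snd \<zeta>)"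
      by (metis matrix_mul_assoc)
    then have "fst g ** M = M ** snd g"
      unfolding g_def one_param_def fst_conv snd_conv L(1) R(1)
      using c by (simp add: matrix_bilinear_simps)
    then show "conf_act g M = M"
      using g by (metis G_iff conf_act_def rotation_matrixD(6))
  qed
  have "conf_act g (conf_act g (conf_act g (conf_act g M)))
      = ((fst g ** fst g) ** (fst g ** fst g)) ** M ** transpose ((snd g ** snd g) ** (snd g ** snd g))"
    by (simp add: conf_act_def matrix_mul_assoc transpose_simps)
  also have "(fst g ** fst g) ** (fst g ** fst g) = mat 1"
    using L(3) by (simp add: g_def one_param_def flip: rot_double[OF \<xi>])
  also have "(snd g ** snd g) ** (snd g ** snd g) = mat 1"
    using R(3) by (simp add: g_def one_param_def flip: rot_double[OF \<eta>])
  finally show "conf_act g (conf_act g (conf_act g (conf_act g M))) = M"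
    by (simp add: transpose_simps)
qed

lemma inner_so3_eq_trace: "A \<in> so3 \<Longrightarrow> A \<bullet> A = - trace (A ** A)"
  by (simp add: inner_mat3 trace_def sum_3 matrix_mult_component_3 so3_components)

lemma Phi_commute:
  assumes \<zeta>: "\<zeta> \<in> so3 \<times> so3" and "inf_cot_act \<zeta> w = 0"
  shows "fst \<zeta> ** Phi_L w = Phi_L w ** fst \<zeta>" "snd \<zeta> ** Phi_R w = Phi_R w ** snd \<zeta>"
proof -
  obtain \<xi> \<eta> Q P where [simp]: "\<zeta> = (\<xi>, \<eta>)" "w = (Q, P)" by (metis surj_pair)
  have Q: "\<xi> ** Q = Q ** \<eta>" and P: "\<xi> ** P = P ** \<eta>"
    using assms(2) by (simp_all add: inf_cot_act_def inf_act_def zero_prod_def)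
  have T: "transpose M ** \<xi> = \<eta> ** transpose M" if "\<xi> ** M = M ** \<eta>" for M
    using arg_cong[OF that, of transpose] \<zeta> by (simp add: transpose_simps so3_transpose matrix_bilinear_simps)
  note c = Q P T[OF Q] T[OF P]
  have a: "\<xi> ** (X ** Y) = (X ** Y) ** \<xi>" if "\<xi> ** X = X ** \<eta>" "Y ** \<xi> = \<eta> ** Y" for X Y
    by (metis matrix_mul_assoc that)
  have b: "\<eta> ** (Y ** X) = (Y ** X) ** \<eta>" if "\<xi> ** X = X ** \<eta>" "Y ** \<xi> = \<eta> ** Y" for X Y
    by (metis matrix_mul_assoc that)
  show "fst \<zeta> ** Phi_L w = Phi_L w ** fst \<zeta>"
    using a[OF c(1) c(4)] a[OF c(2) c(3)] by (simp add: Phi_L_def matrix_bilinear_simps)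
  show "snd \<zeta> ** Phi_R w = Phi_R w ** snd \<zeta>"
    using b[OF c(1) c(4)] b[OF c(2) c(3)] by (simp add: Phi_R_def matrix_bilinear_simps)
qed

text \<open>With a nontrivial isotropy algebra, restrict to the matrices fixed by a cyclic subgroup of
  order four of the isotropy group, the image of the averaging map \<open>avg\<close>. There the whole momentum is
  determined by its component along \<open>\<xi>\<close>, whose derivative does not vanish, so that the multiplier rule
  applies; and invariance makes the derivative of \<open>f\<close> factor through \<open>avg\<close>.\<close>
lemma critical_point_isotropy:
  assumes S: "open S" "z \<in> S" and cont: "continuous_on S f" and D: "(f has_derivative D) (at z)"
    and inv: "\<And>g w. g \<in> G \<Longrightarrow> w \<in> S \<Longrightarrow> f (cot_act g w) = f w"
    and min: "\<And>w. w \<in> S \<Longrightarrow> Phi w = Phi z \<Longrightarrow> f z \<le> f w"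
    and Q: "invertible (fst z)"
    and \<zeta>: "\<zeta> \<in> so3 \<times> so3" "\<zeta> \<noteq> 0" "inf_cot_act \<zeta> z = 0"
  obtains \<zeta>' where "\<zeta>' \<in> so3 \<times> so3" "\<And>v. D v = symplectic_form (inf_cot_act \<zeta>' z) v"
proof -
  define \<xi> \<eta> where "\<xi> = fst \<zeta>" and "\<eta> = snd \<zeta>"
  have \<zeta>_eq: "\<zeta> = (\<xi>, \<eta>)" by (simp add: \<xi>_def \<eta>_def)
  have \<xi>\<eta>: "\<xi> \<in> so3" "\<eta> \<in> so3" using \<zeta>(1) by (auto simp: \<zeta>_eq)
  have zQ: "\<xi> ** fst z = fst z ** \<eta>"
    using \<zeta>(3) by (simp add: \<zeta>_eq inf_cot_act_def inf_act_def zero_prod_def)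
  obtain R where R: "fst z ** R = mat 1" "R ** fst z = mat 1"
    using Q unfolding invertible_def by blast
  have \<eta>_eq: "\<eta> = R ** (\<xi> ** fst z)" by (simp add: zQ matrix_mul_assoc R)
  \<comment> \<open>\<open>\<xi>\<close> and \<open>\<eta>\<close> are conjugate, so that a common time makes both rotations quarter turns.\<close>
  have norm_eq: "\<eta> \<bullet> \<eta> = \<xi> \<bullet> \<xi>"
  proof -
    have "trace (\<eta> ** \<eta>) = trace (R ** (\<xi> ** fst z ** \<eta>))"
      by (subst (1) \<eta>_eq) (simp add: matrix_mul_assoc)
    also have "\<dots> = trace (\<xi> ** (fst z ** \<eta> ** R))"
      by (subst trace_mul_sym) (simp add: matrix_mul_assoc)
    also have "fst z ** \<eta> ** R = \<xi>"
      by (simp flip: zQ matrix_mul_assoc add: R)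
    finally show ?thesis by (simp add: inner_so3_eq_trace \<xi>\<eta>)
  qed
  have "\<xi> \<noteq> 0"
    using \<zeta>(2) \<eta>_eq by (auto simp: \<zeta>_eq matrix_bilinear_simps zero_prod_def)
  define k where "k = sqrt (\<xi> \<bullet> \<xi> / 2)"
  have k: "k > 0" "fst \<zeta> \<bullet> fst \<zeta> / 2 = k\<^sup>2" "snd \<zeta> \<bullet> snd \<zeta> / 2 = k\<^sup>2"
    using so3_rate[of \<xi>] \<open>\<xi> \<noteq> 0\<close> norm_eq by (simp_all add: k_def \<zeta>_eq)
  define g where "g = one_param \<zeta> (pi / 2 / k)"
  have g: "g \<in> G" by (simp add: g_def one_param_mem \<zeta>(1))
  note quarter = quarter_turn[OF \<zeta>(1) k, folded g_def]
  have fixed_iff: "cot_act g w = w \<longleftrightarrow> inf_cot_act \<zeta> w = 0" for w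
    using quarter(1) by (simp add: cot_act_def inf_cot_act_def prod_eq_iff)
  have four: "cot_act g (cot_act g (cot_act g (cot_act g w))) = w" for w
    using quarter(2) by (simp add: cot_act_def)
  have gz: "cot_act g z = z" using \<zeta>(3) fixed_iff by simp
  define avg where "avg w = (1/4) *\<^sub>R (w + cot_act g w + cot_act g (cot_act g w)
      + cot_act g (cot_act g (cot_act g w)))" for w
  note lin = linear_add[OF linear_cot_act] linear_cmul[OF linear_cot_act]
  have avg_lin: "linear avg"
    by (rule linearI) (simp_all add: avg_def lin algebra_simps)
  then have avg_blin: "bounded_linear avg" by (simp add: linear_conv_bounded_linear)
  have g_avg: "cot_act g (avg w) = avg w" for w
    by (simp add: avg_def lin four algebra_simps)
  have avg_fixed: "avg w = w" if "cot_act g w = w" for w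
    by (simp add: avg_def that prod_eq_iff vec_eq_iff)
  have avg_z: "avg z = z" using gz by (rule avg_fixed)
  have factor: "T (avg v) = T v" if "linear T" "\<And>v. T (cot_act g v) = T v" for T :: "mat3 \<times> mat3 \<Rightarrow> real" and v
    by (simp add: avg_def linear_add[OF that(1)] linear_cmul[OF that(1)] that(2))
  \<comment> \<open>Both momenta of a fixed point are parallel to the axes, and \<open>momentum \<zeta>\<close> vanishes, which ties the two
    coefficients together.\<close>
  have \<xi>0: "(\<xi>, 0) \<in> so3 \<times> so3" using \<xi>\<eta> subspace_0[OF subspace_so3] by simp
  have Phi_eq: "Phi w = Phi z" if w: "cot_act g w = w" and m: "momentum (\<xi>, 0) w = momentum (\<xi>, 0) z" for w
  proof -
    have "(\<xi> \<bullet> \<xi>) *\<^sub>R Phi_L w = momentum (\<xi>, 0) w *\<^sub>R \<xi>"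
      "(\<xi> \<bullet> \<xi>) *\<^sub>R Phi_R w = - momentum (\<xi>, 0) w *\<^sub>R \<eta>" if "cot_act g w = w" for w
    proof -
      have 0: "inf_cot_act \<zeta> w = 0" using that fixed_iff by simp
      then have "momentum \<zeta> w = 0" by (simp add: momentum_def inf_cot_act_def zero_prod_def)
      then have "\<eta> \<bullet> Phi_R w = - (\<xi> \<bullet> Phi_L w)"
        using momentum_eq_Phi[OF \<zeta>(1), of w] by (simp add: \<zeta>_eq)
      moreover have "momentum (\<xi>, 0) w = \<xi> \<bullet> Phi_L w"
        by (simp add: momentum_eq_Phi[OF \<xi>0])
      ultimately show "(\<xi> \<bullet> \<xi>) *\<^sub>R Phi_L w = momentum (\<xi>, 0) w *\<^sub>R \<xi>"
          "(\<xi> \<bullet> \<xi>) *\<^sub>R Phi_R w = - momentum (\<xi>, 0) w *\<^sub>R \<eta>"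
        using so3_commute_parallel[OF \<xi>\<eta>(1) Phi_mem_so3(1), of w]
          so3_commute_parallel[OF \<xi>\<eta>(2) Phi_mem_so3(2), of w] Phi_commute[OF \<zeta>(1) 0]
        by (simp_all add: \<zeta>_eq norm_eq)
    qed
    from this[OF w] this[OF gz] have "(\<xi> \<bullet> \<xi>) *\<^sub>R Phi_L w = (\<xi> \<bullet> \<xi>) *\<^sub>R Phi_L z"
      "(\<xi> \<bullet> \<xi>) *\<^sub>R Phi_R w = (\<xi> \<bullet> \<xi>) *\<^sub>R Phi_R z" by (simp_all add: m)
    then show ?thesis using \<open>\<xi> \<noteq> 0\<close> by (simp add: Phi_def)
  qed
  define m' where "m' = symplectic_form (inf_cot_act (\<xi>, 0) z)"
  have dm: "(momentum (\<xi>, 0) has_derivative m') (at z)"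
    unfolding m'_def by (rule momentum_has_derivative[OF \<xi>0])
  have contavg: "continuous_on T avg" for T by (rule linear_continuous_on[OF avg_blin])
  define S' where "S' = avg -` S"
  have S': "open S'" "z \<in> S'"
    using S open_vimage[OF S(1) contavg] by (simp_all add: S'_def avg_z)
  have davg: "((\<lambda>w. h (avg w)) has_derivative (\<lambda>v. h' (avg v))) (at z)"
    if "(h has_derivative h') (at z)" for h h' :: "mat3 \<times> mat3 \<Rightarrow> real"
    using has_derivative_compose[OF bounded_linear.has_derivative[OF avg_blin has_derivative_ident], of h h'] that
    by (simp add: avg_z)
  have contf: "continuous_on S' (\<lambda>w. f (avg w))"
    by (rule continuous_on_compose2[OF cont contavg]) (auto simp: S'_def)
  have contm: "continuous_on S' (\<lambda>w. momentum (\<xi>, 0) (avg w))"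
    using momentum_has_derivative[OF \<xi>0] has_derivative_continuous
    by (intro continuous_on_compose2[OF continuous_at_imp_continuous_on contavg, of UNIV]) blast+
  have minavg: "f (avg z) \<le> f (avg w)"
    if "w \<in> S'" "momentum (\<xi>, 0) (avg w) = momentum (\<xi>, 0) (avg z)" for w
    using that Phi_eq[OF g_avg, of w] min[of "avg w"] by (simp add: S'_def avg_z)
  obtain y c where yc: "(y, c) \<noteq> 0" "\<And>v. y \<bullet> m' (avg v) + c * D (avg v) = 0"
    by (rule fritz_john_multiplier[OF S' contf contm davg[OF D] davg[OF dm] minavg]) auto
  have \<xi>_fixed: "cot_act g (\<xi> ** A, \<xi> ** B) = (\<xi> ** A, \<xi> ** B)" if "cot_act g (A, B) = (A, B)" for A B
    using that unfolding fixed_iff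
    by (auto simp: inf_cot_act_def inf_act_def \<zeta>_eq zero_prod_def matrix_mul_assoc)
  \<comment> \<open>A fixed direction along which \<open>momentum (\<xi>, 0)\<close> grows, so that \<open>c\<close> is not zero.\<close>
  have "cot_act g (0, fst z) = (0, fst z)" using gz
    by (simp add: cot_act_def linear_0[OF linear_conf_act] prod_eq_iff)
  from \<xi>_fixed[OF this] have X: "avg (0, \<xi> ** fst z) = (0, \<xi> ** fst z)"
    by (intro avg_fixed) (simp add: matrix_bilinear_simps)
  have "\<xi> ** fst z \<noteq> 0"
  proof
    assume "\<xi> ** fst z = 0"
    then have "\<xi> ** fst z ** R = 0" by (simp add: matrix_bilinear_simps)
    then show False using \<open>\<xi> \<noteq> 0\<close> by (simp add: R flip: matrix_mul_assoc)
  qed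
  then have "m' (avg (0, \<xi> ** fst z)) \<noteq> 0"
    by (simp add: X m'_def symplectic_form_def inf_cot_act_def inf_act_def matrix_bilinear_simps)
  then have "c \<noteq> 0" using yc(1) yc(2)[of "(0, \<xi> ** fst z)"] by (auto simp: zero_prod_def)
  have "D (cot_act g v) = D v" for v
  proof -
    have "((\<lambda>w. f (cot_act g w)) has_derivative (\<lambda>v. D (cot_act g v))) (at z)"
      using has_derivative_compose[OF bounded_linear_imp_has_derivative[OF bounded_linear_cot_act[of g]], of f D z UNIV] D
      by (simp add: gz)
    then have "(f has_derivative (\<lambda>v. D (cot_act g v))) (at z)"
      using S inv[OF g] by (rule has_derivative_transform_within_open)
    then have "(\<lambda>v. D (cot_act g v)) = D" using D has_derivative_unique by blast
    then show ?thesis by (rule fun_cong)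
  qed
  then have D_avg: "D (avg v) = D v" for v
    using D has_derivative_linear by (intro factor) blast+
  have "m' (cot_act g v) = m' v" for v
    using symplectic_form_cot_act[OF g, of "inf_cot_act (\<xi>, 0) z" v] \<xi>_fixed[of "fst z" "snd z"] gz
    by (simp add: m'_def inf_cot_act_def inf_act_def matrix_bilinear_simps)
  then have m_avg: "m' (avg v) = m' v" for v
    using dm has_derivative_linear by (intro factor) blast+
  show ?thesis
  proof (rule that[of "((- y / c) *\<^sub>R \<xi>, 0)"])
    show "((- y / c) *\<^sub>R \<xi>, 0) \<in> so3 \<times> so3"
      using \<xi>0 subspace_so3 by (auto simp: subspace_scale subspace_neg)
    fix v
    show "D v = symplectic_form (inf_cot_act ((- y / c) *\<^sub>R \<xi>, 0) z) v"
      using yc(2)[of v] \<open>c \<noteq> 0\<close> unfolding D_avg m_avg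
      by (simp add: m'_def symplectic_form_def inf_cot_act_def inf_act_def matrix_bilinear_simps field_simps)
  qed
qed

lemma critical_point_on_momentum_level:
  assumes S: "open S" "z \<in> S" and "continuous_on S f" and "(f has_derivative D) (at z)"
    and "\<And>g w. g \<in> G \<Longrightarrow> w \<in> S \<Longrightarrow> f (cot_act g w) = f w"
    and "\<And>w. w \<in> S \<Longrightarrow> Phi w = Phi z \<Longrightarrow> f z \<le> f w"
    and "invertible (fst z)"
  obtains \<zeta> where "\<zeta> \<in> so3 \<times> so3" "\<And>v. D v = symplectic_form (inf_cot_act \<zeta> z) v"
proof (cases "\<exists>\<zeta> \<in> so3 \<times> so3. inf_cot_act \<zeta> z = 0 \<and> \<zeta> \<noteq> 0")
  case True
  then show ?thesis using critical_point_isotropy[OF assms] that by metis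
next
  case False
  then show ?thesis using critical_point_free[OF assms(1-4,6)] that by metis
qed

section \<open>The phase spaces of \<open>SL(3)\<close> and \<open>GL(3)\<close>\<close>

text \<open>The cofactor matrix, that is \<open>det Q\<close> times the inverse transpose, in the polynomial form that
  the Cayley-Hamilton theorem provides.\<close>
definition cof :: "mat3 \<Rightarrow> mat3" where
  "cof Q = transpose (Q ** Q - trace Q *\<^sub>R Q + (((trace Q)\<^sup>2 - trace (Q ** Q)) / 2) *\<^sub>R mat 1)"

lemma trace_mat3: "trace A = A$1$1 + A$2$2 + A$3$3" for A :: mat3
  by (simp add: trace_def sum_3)

lemma cof_components:
  "cof Q $1$1 = Q$2$2 * Q$3$3 - Q$2$3 * Q$3$2"
  "cof Q $1$2 = Q$2$3 * Q$3$1 - Q$2$1 * Q$3$3"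
  "cof Q $1$3 = Q$2$1 * Q$3$2 - Q$2$2 * Q$3$1"
  "cof Q $2$1 = Q$1$3 * Q$3$2 - Q$1$2 * Q$3$3"
  "cof Q $2$2 = Q$1$1 * Q$3$3 - Q$1$3 * Q$3$1"
  "cof Q $2$3 = Q$1$2 * Q$3$1 - Q$1$1 * Q$3$2"
  "cof Q $3$1 = Q$1$2 * Q$2$3 - Q$1$3 * Q$2$2"
  "cof Q $3$2 = Q$1$3 * Q$2$1 - Q$1$1 * Q$2$3"
  "cof Q $3$3 = Q$1$1 * Q$2$2 - Q$1$2 * Q$2$1"
  by (simp_all add: cof_def transpose_def trace_mat3 matrix_mult_component_3 mat_def power2_eq_square
      field_simps)

lemma mat_component_3: "(mat a :: mat3) $ i $ j = (if i = j then a else 0)"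
  by (simp add: mat_def)

lemma cof_mult: "Q ** transpose (cof Q) = det Q *\<^sub>R mat 1" for Q :: mat3
  by (simp add: mat3_eq_iff matrix_mult_component_3 transpose_def[of "cof Q"] cof_components det_3
      mat_component_3 algebra_simps)

lemma linear_component: "linear (\<lambda>A::mat3. A$i$j)"
  by (rule linearI) simp_all

lemma component_has_derivative: "((\<lambda>A::mat3. A$i$j) has_derivative (\<lambda>P. P$i$j)) (at Q within T)"
  using linear_component[of i j] by (simp add: bounded_linear_imp_has_derivative linear_conv_bounded_linear)

text \<open>Jacobi's formula.\<close>
lemma det_has_derivative: "(det has_derivative (\<lambda>P. cof Q \<bullet> P)) (at Q)" for Q :: mat3
proof -
  have "((\<lambda>A::mat3. det A) has_derivative (\<lambda>P. cof Q \<bullet> P)) (at Q)"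
    unfolding det_3
    by (rule has_derivative_eq_rhs, (rule derivative_intros component_has_derivative)+)
       (simp add: fun_eq_iff inner_mat3 cof_components algebra_simps)
  then show ?thesis by simp
qed

lemma continuous_on_det3 [continuous_intros]: "continuous_on S (det :: mat3 \<Rightarrow> real)"
  using det_has_derivative has_derivative_continuous by (metis continuous_at_imp_continuous_on)

lemma linear_trace: "linear (trace :: mat3 \<Rightarrow> real)"
  by (rule linearI) (simp_all add: trace_mat3 algebra_simps)

lemma cof_has_derivative: "\<exists>cof'. (cof has_derivative cof') (at Q)"
proof -
  note tr = bounded_linear.has_derivative[OF linear_trace[unfolded linear_conv_bounded_linear]]
  have cof: "cof = (\<lambda>Q. transpose (Q ** Q - trace Q *\<^sub>R Q + ((trace Q * trace Q - trace (Q ** Q)) * (1/2)) *\<^sub>R mat 1))"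
    by (rule ext) (simp add: cof_def power2_eq_square)
  show ?thesis unfolding cof by (rule exI) (rule derivative_intros tr)+
qed

lemma continuous_on_cof [continuous_intros]: "continuous_on S cof"
  using cof_has_derivative has_derivative_continuous by (metis continuous_at_imp_continuous_on)

lemma cof_nonzero:
  assumes "det Q \<noteq> 0"
  shows "cof Q \<noteq> 0"
proof
  assume "cof Q = 0"
  then have "det Q *\<^sub>R (mat 1 :: mat3) = 0" using cof_mult[of Q] by (simp add: transpose_simps matrix_bilinear_simps)
  then show False using assms by (simp add: mat3_eq_iff mat_component_3)
qed

lemma cof_scaleR: "cof (a *\<^sub>R Q) = a\<^sup>2 *\<^sub>R cof Q"
  by (simp add: mat3_eq_iff cof_components power2_eq_square algebra_simps)

lemma det_scaleR: "det (a *\<^sub>R Q) = a ^ 3 * det Q" for Q :: mat3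
  by (simp add: det_3 power3_eq_cube algebra_simps)

lemma det_conf_act: "g \<in> G \<Longrightarrow> det (conf_act g Q) = det Q"
  by (simp add: conf_act_def det_mul det_transpose G_iff rotation_matrixD)

lemma invertible_iff_det: "invertible Q \<longleftrightarrow> det Q \<noteq> 0" for Q :: mat3
  by (rule invertible_det_nz)

text \<open>For invertible \<open>Q\<close> the identity \<open>cof_mult\<close> determines the cofactor matrix.\<close>
lemma cof_conf_act:
  assumes g: "g \<in> G" and Q: "det Q \<noteq> 0"
  shows "cof (conf_act g Q) = conf_act g (cof Q)"
proof -
  obtain R where R: "R ** conf_act g Q = mat 1"
    using Q g by (metis det_conf_act invertible_iff_det invertible_def)
  have "conf_act g Q ** transpose (conf_act g (cof Q))
      = fst g ** (Q ** transpose (cof Q)) ** transpose (fst g)"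
    using g by (simp add: conf_act_def transpose_simps G_iff rotation_matrixD flip: matrix_mul_assoc)
  also have "\<dots> = det Q *\<^sub>R mat 1"
    using g by (simp add: cof_mult matrix_bilinear_simps G_iff rotation_matrixD)
  also have "\<dots> = conf_act g Q ** transpose (cof (conf_act g Q))"
    by (simp add: cof_mult det_conf_act g)
  finally have "R ** conf_act g Q ** transpose (conf_act g (cof Q))
      = R ** conf_act g Q ** transpose (cof (conf_act g Q))"
    by (simp flip: matrix_mul_assoc)
  then show ?thesis by (metis R matrix_mul_lid transpose_transpose)
qed

lemma tangent_space_map:
  assumes "(f has_derivative f') (at x)" "f ` S \<subseteq> T" "v \<in> tangent_space S x"
  shows "f' v \<in> tangent_space T (f x)"
proof -
  obtain c where c: "\<And>t. c t \<in> S" "c 0 = x" "(c has_vector_derivative v) (at 0)"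
    using assms(3) by (auto simp: tangent_space_def)
  have "((\<lambda>t. f (c t)) has_derivative (\<lambda>t. f' (t *\<^sub>R v))) (at 0)"
    using has_derivative_compose[of c "\<lambda>t. t *\<^sub>R v" 0 UNIV f f'] c assms(1)
    by (simp add: has_vector_derivative_def)
  moreover have "(\<lambda>t. f' (t *\<^sub>R v)) = (\<lambda>t. t *\<^sub>R f' v)"
    using assms(1) has_derivative_linear linear_cmul by blast
  ultimately have "((\<lambda>t. f (c t)) has_vector_derivative f' v) (at 0)"
    by (simp add: has_vector_derivative_def)
  then show ?thesis
    unfolding tangent_space_def using assms(2) c(1,2) by (intro CollectI exI[of _ "\<lambda>t. f (c t)"]) auto
qed

text \<open>A line leaves an open set after some time; traversed as \<open>d sin (t / d)\<close> with \<open>d\<close> small, it stays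
  inside for all times.\<close>
lemma tangent_space_open:
  assumes "open S" "x \<in> S"
  shows "tangent_space S x = UNIV"
proof -
  have "v \<in> tangent_space S x" for v
  proof -
    obtain e where e: "e > 0" "ball x e \<subseteq> S" using assms by (meson openE)
    define d where "d = e / (norm v + 1)"
    have "norm v + 1 > 0" by (simp add: add_nonneg_pos)
    then have d: "d > 0" "d * norm v < e"
      using e(1) by (simp_all add: d_def field_simps)
    define c where "c t = x + (d * sin (t / d)) *\<^sub>R v" for t
    have "\<bar>d * sin (t / d)\<bar> * norm v \<le> d * norm v" for t
      using d(1) by (intro mult_right_mono) (auto simp: abs_mult)
    then have "c t \<in> ball x e" for t
      using d by (simp add: c_def dist_norm) (meson le_less_trans)
    moreover have "((\<lambda>t. d * sin (t / d)) has_real_derivative 1) (at 0)"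
      using d(1) by (auto intro!: derivative_eq_intros)
    then have "(c has_vector_derivative v) (at 0)"
      unfolding c_def
      by (rule has_vector_derivative_eq_rhs[OF has_vector_derivative_add[OF
            has_vector_derivative_const has_vector_derivative_scaleR[OF _ has_vector_derivative_const]]]) simp
    ultimately show ?thesis
      using e(2) by (auto simp: tangent_space_def c_def intro!: exI[of _ c])
  qed
  then show ?thesis by blast
qed

definition unimod :: "mat3 \<Rightarrow> mat3" where
  "unimod Q = (det Q powr (- 1/3)) *\<^sub>R Q"

lemma det_powr_third: "det Q > 0 \<Longrightarrow> (det Q powr (- 1/3)) ^ 3 * det Q = 1" for Q :: mat3
  using powr_power[where z = "det Q" and u = "- 1/3" and n = 3] by (simp add: powr_minus_divide)

lemma det_unimod: "det Q > 0 \<Longrightarrow> det (unimod Q) = 1"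
  using det_powr_third by (simp add: unimod_def det_scaleR)

lemma unimod_has_derivative:
  assumes "det Q > 0"
  shows "\<exists>f'. (unimod has_derivative f') (at Q) \<and> (det Q = 1 \<longrightarrow> (\<forall>P. f' P = P - (cof Q \<bullet> P / 3) *\<^sub>R Q))"
proof -
  have "((\<lambda>Q. det Q powr (- 1/3)) has_derivative (\<lambda>P. (- 1/3) * det Q powr (- 1/3 - 1) * (cof Q \<bullet> P))) (at Q)"
    by (rule has_derivative_compose[OF det_has_derivative
          has_real_derivative_powr[OF assms, unfolded has_field_derivative_def]])
  from has_derivative_scaleR[OF this has_derivative_ident]
  show ?thesis unfolding unimod_def[abs_def] by (intro exI conjI) (auto simp: algebra_simps)
qed

lemma open_pos_det: "open {Q::mat3. det Q > 0}"
  using open_Collect_less[OF continuous_on_const continuous_on_det3] by simp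

lemma open_GL3: "open GL3"
  using open_Collect_neq[OF continuous_on_det3 continuous_on_const[of UNIV 0]]
  by (simp add: GL3_def invertible_iff_det)

text \<open>A direction that annihilates the differential of \<open>det\<close> is the velocity of a line normalised to
  determinant \<open>1\<close>.\<close>
lemma tangent_space_SL3:
  assumes "Q \<in> SL3"
  shows "tangent_space SL3 Q = {P. cof Q \<bullet> P = 0}"
proof (intro equalityI subsetI CollectI)
  fix P assume "P \<in> tangent_space SL3 Q"
  then have "cof Q \<bullet> P \<in> tangent_space {1} (det Q)"
    by (rule tangent_space_map[OF det_has_derivative, rotated]) (auto simp: SL3_def)
  then obtain c where "\<And>t. c t = 1" "(c has_vector_derivative (cof Q \<bullet> P)) (at 0)"
    by (auto simp: tangent_space_def)
  moreover from this have "c = (\<lambda>t. 1)" by auto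
  ultimately show "cof Q \<bullet> P = 0"
    using vector_derivative_unique_at has_vector_derivative_const by metis
next
  fix P assume P: "P \<in> {P. cof Q \<bullet> P = 0}"
  have Q: "det Q = 1" using assms by (simp add: SL3_def)
  obtain f' where f': "(unimod has_derivative f') (at Q)" "f' P = P"
    using unimod_has_derivative[of Q] Q P by auto
  have "P \<in> tangent_space {Q. det Q > 0} Q"
    using tangent_space_open[OF open_pos_det] Q by simp
  moreover have "unimod ` {Q. det Q > 0} \<subseteq> SL3" by (auto simp: SL3_def det_unimod)
  ultimately have "f' P \<in> tangent_space SL3 (unimod Q)" using f'(1) tangent_space_map by blast
  then show "P \<in> tangent_space SL3 Q" using f'(2) Q by (simp add: unimod_def)
qed

lemma cotangent_SL3: "cotangent SL3 = {z. det (fst z) = 1 \<and> cof (fst z) \<bullet> snd z = 0}"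
  using tangent_space_SL3 by (auto simp: cotangent_def SL3_def)

lemma cotangent_GL3: "cotangent GL3 = GL3 \<times> UNIV"
  using tangent_space_open[OF open_GL3] by (auto simp: cotangent_def)

lemma conf_act_mem:
  assumes "Qs = SL3 \<or> Qs = GL3" "g \<in> G" "Q \<in> Qs"
  shows "conf_act g Q \<in> Qs"
  using assms by (auto simp: SL3_def GL3_def invertible_iff_det det_conf_act)

lemma cot_act_mem:
  assumes "Qs = SL3 \<or> Qs = GL3" "g \<in> G" "z \<in> cotangent Qs"
  shows "cot_act g z \<in> cotangent Qs"
  using assms(1)
proof
  assume "Qs = SL3"
  then show ?thesis using assms(2,3)
    by (simp add: cotangent_SL3 cot_act_def det_conf_act cof_conf_act conf_act_inner)
next
  assume "Qs = GL3"
  then show ?thesis using conf_act_mem[of GL3 g "fst z"] assms(2,3)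
    by (auto simp: cotangent_GL3 cot_act_def)
qed

text \<open>For \<open>SL(3)\<close> the covector is scaled against the configuration, which leaves the momentum
  unchanged, and then projected along the cofactor matrix, on which the momentum vanishes.\<close>
definition unimod_cot :: "mat3 \<times> mat3 \<Rightarrow> mat3 \<times> mat3" where
  "unimod_cot z = (unimod (fst z), (det (fst z) powr (1/3)) *\<^sub>R
     (snd z - ((cof (fst z) \<bullet> snd z) / (cof (fst z) \<bullet> cof (fst z))) *\<^sub>R cof (fst z)))"

lemma Phi_unimod_cot:
  assumes "det (fst z) > 0"
  shows "Phi (unimod_cot z) = Phi z"
proof -
  obtain Q P where [simp]: "z = (Q, P)" by (metis surj_pair)
  have Q: "det Q > 0" using assms by simp
  define a b s where "a = det Q powr (- 1/3)" and "b = det Q powr (1/3)"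
    and "s = (cof Q \<bullet> P) / (cof Q \<bullet> cof Q)"
  have ab: "a * b = 1" using Q by (simp add: a_def b_def flip: powr_add)
  have sym: "transpose (cof Q) ** Q = transpose Q ** cof Q" "cof Q ** transpose Q = Q ** transpose (cof Q)"
    by (simp_all add: mat3_eq_iff matrix_mult_component_3 transpose_def cof_components algebra_simps)
  have u: "unimod_cot z = (a *\<^sub>R Q, b *\<^sub>R (P - s *\<^sub>R cof Q))"
    by (simp add: unimod_cot_def unimod_def a_def b_def s_def)
  have "Phi_L (unimod_cot z) = (a * b) *\<^sub>R Phi_L z" "Phi_R (unimod_cot z) = (a * b) *\<^sub>R Phi_R z"
    unfolding u by (simp_all add: Phi_L_def Phi_R_def transpose_simps matrix_bilinear_simps sym algebra_simps)
  then show ?thesis using ab by (simp add: Phi_def)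
qed

lemma unimod_cot_differentiable:
  assumes "det (fst z) > 0"
  shows "unimod_cot differentiable (at z)"
proof -
  have cof: "(\<lambda>z. cof (fst z)) differentiable (at z)"
    using cof_has_derivative[of "fst z"] has_derivative_compose[OF has_derivative_fst[OF has_derivative_ident]]
    unfolding differentiable_def by blast
  have det: "(\<lambda>z. det (fst z)) differentiable (at z)"
    using det_has_derivative[of "fst z"] has_derivative_compose[OF has_derivative_fst[OF has_derivative_ident]]
    unfolding differentiable_def by blast
  have powr: "(\<lambda>z. det (fst z) powr (1/3)) differentiable (at z)"
    using det assms has_derivative_powr[OF _ has_derivative_const, of "\<lambda>z. det (fst z)"]
    unfolding differentiable_def by blast
  have uni: "(\<lambda>z. unimod (fst z)) differentiable (at z)"
    using unimod_has_derivative[OF assms] has_derivative_compose[OF has_derivative_fst[OF has_derivative_ident]]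
    unfolding differentiable_def by blast
  have snd: "snd differentiable (at z)" by (rule bounded_linear_imp_differentiable[OF bounded_linear_snd])
  show ?thesis unfolding unimod_cot_def[abs_def]
    by (intro differentiable_Pair uni differentiable_scaleR powr differentiable_diff snd differentiable_divide
        differentiable_inner cof) (use assms cof_nonzero in auto)
qed

text \<open>This turns a minimum over the phase space with given momentum into one over an open set of pairs of matrices,
  where the multiplier rule applies.\<close>
lemma cotangent_retraction:
  assumes "Qs = SL3 \<or> Qs = GL3"
  obtains \<Omega> r where "open \<Omega>" "cotangent Qs \<subseteq> \<Omega>"
    "\<And>z. z \<in> \<Omega> \<Longrightarrow> r z \<in> cotangent Qs \<and> invertible (fst z) \<and> Phi (r z) = Phi z \<and> r differentiable (at z)"
    "\<And>g z. g \<in> G \<Longrightarrow> z \<in> \<Omega> \<Longrightarrow> cot_act g z \<in> \<Omega> \<and> r (cot_act g z) = cot_act g (r z)"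
    "\<And>z. z \<in> cotangent Qs \<Longrightarrow> r z = z"
  using assms
proof
  assume Qs: "Qs = GL3"
  show ?thesis
  proof (rule that[of "GL3 \<times> UNIV" "\<lambda>z. z"])
    show "open (GL3 \<times> (UNIV :: mat3 set))" by (intro open_Times open_GL3 open_UNIV)
  next
    fix g z assume "g \<in> G" "z \<in> GL3 \<times> (UNIV :: mat3 set)"
    then show "cot_act g z \<in> GL3 \<times> UNIV \<and> cot_act g z = cot_act g z"
      using cot_act_mem[of GL3 g z] by (simp add: cotangent_GL3)
  qed (auto simp: Qs cotangent_GL3, simp add: GL3_def)
next
  assume Qs: "Qs = SL3"
  show ?thesis
  proof (rule that[of "{Q. det Q > 0} \<times> UNIV" unimod_cot])
    show "open ({Q::mat3. det Q > 0} \<times> (UNIV :: mat3 set))" by (intro open_Times open_pos_det open_UNIV)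
    show "cotangent Qs \<subseteq> {Q. det Q > 0} \<times> UNIV" by (auto simp: Qs cotangent_SL3)
    show "unimod_cot z = z" if "z \<in> cotangent Qs" for z
      using that by (simp add: Qs cotangent_SL3 unimod_cot_def unimod_def)
    show "cot_act g z \<in> {Q. det Q > 0} \<times> UNIV \<and> unimod_cot (cot_act g z) = cot_act g (unimod_cot z)"
      if "g \<in> G" "z \<in> {Q. det Q > 0} \<times> UNIV" for g z
      using that by (auto simp: cot_act_def unimod_cot_def unimod_def det_conf_act cof_conf_act conf_act_inner
        linear_diff[OF linear_conf_act] linear_cmul[OF linear_conf_act])
    fix z :: "mat3 \<times> mat3" assume "z \<in> {Q. det Q > 0} \<times> UNIV"
    then have z: "det (fst z) > 0" by auto
    have "cof (fst z) \<bullet> cof (fst z) \<noteq> 0" using cof_nonzero[of "fst z"] z by auto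
    then have "unimod_cot z \<in> cotangent Qs"
      using z by (simp add: Qs cotangent_SL3 unimod_cot_def det_unimod)
        (simp add: unimod_def cof_scaleR inner_diff_right)
    then show "unimod_cot z \<in> cotangent Qs \<and> invertible (fst z) \<and> Phi (unimod_cot z) = Phi z
        \<and> unimod_cot differentiable (at z)"
      using z by (simp add: invertible_iff_det Phi_unimod_cot unimod_cot_differentiable)
  qed
qed

section \<open>Relative equilibria from minima on momentum levels\<close>

lemma coad_mult: "coad (fst g ** fst k, snd g ** snd k) \<mu> = coad g (coad k \<mu>)"
  by (simp add: coad_def transpose_simps matrix_mul_assoc)

lemma cot_act_mult: "cot_act (fst g ** fst k, snd g ** snd k) z = cot_act g (cot_act k z)"
  by (simp add: cot_act_def conf_act_def transpose_simps matrix_mul_assoc)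

lemma isotropy_mult:
  "g \<in> isotropy \<mu> \<Longrightarrow> k \<in> isotropy \<mu> \<Longrightarrow> (fst g ** fst k, snd g ** snd k) \<in> isotropy \<mu>"
  by (simp add: isotropy_def coad_mult G_iff rotation_matrix_mult)

lemma isotropy_inv:
  assumes "g \<in> isotropy \<mu>"
  shows "G_inv g \<in> isotropy \<mu>"
proof -
  have g: "g \<in> G" "coad g \<mu> = \<mu>" using assms by (auto simp: isotropy_def)
  have "coad (G_inv g) (coad g \<mu>) = \<mu>"
    using g(1) by (simp add: coad_def G_inv_def G_iff transpose_simps rotation_matrixD flip: matrix_mul_assoc)
  then show ?thesis using g by (simp add: isotropy_def G_inv_mem)
qed

lemma orbit_isotropy_cot_act:
  assumes "g \<in> isotropy \<mu>"
  shows "orbit cot_act (isotropy \<mu>) (cot_act g z) = orbit cot_act (isotropy \<mu>) z"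
proof -
  have g: "g \<in> G" using assms by (simp add: isotropy_def)
  have "cot_act k (cot_act g z) \<in> orbit cot_act (isotropy \<mu>) z" if "k \<in> isotropy \<mu>" for k
    using isotropy_mult[OF that assms] by (auto simp: orbit_def cot_act_mult[symmetric])
  moreover have "cot_act k z \<in> orbit cot_act (isotropy \<mu>) (cot_act g z)" if "k \<in> isotropy \<mu>" for k
  proof -
    have "cot_act k z = cot_act (fst k ** fst (G_inv g), snd k ** snd (G_inv g)) (cot_act g z)"
      by (simp only: cot_act_mult cot_act_inv(1)[OF g])
    then show ?thesis
      unfolding orbit_def using isotropy_mult[OF that isotropy_inv[OF assms]] by (rule image_eqI)
  qed
  ultimately show ?thesis by (auto simp: orbit_def)
qed

lemma G_eq_isotropy: "G = isotropy 0"
  by (auto simp: isotropy_def coad_def matrix_bilinear_simps zero_prod_def)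

lemma mem_orbit_isotropy: "z \<in> orbit cot_act (isotropy \<mu>) z"
proof -
  have "(mat 1, mat 1) \<in> isotropy \<mu>"
    by (simp add: isotropy_def G_iff coad_def transpose_simps rotation_matrix_def orthogonal_matrix_id)
  moreover have "cot_act (mat 1, mat 1) z = z"
    by (simp add: cot_act_def conf_act_def transpose_simps)
  ultimately show ?thesis unfolding orbit_def by (metis image_eqI)
qed

text \<open>Invariance of \<open>U\<close> makes its trace on the momentum level saturated, hence the preimage of an open set
  of the reduced space.\<close>
lemma local_extremum_reduced_space:
  assumes U: "openin (top_of_set (cotangent Qs)) U" "\<And>g w. g \<in> G \<Longrightarrow> w \<in> U \<Longrightarrow> cot_act g w \<in> U"
    and inv: "\<And>g w. g \<in> G \<Longrightarrow> w \<in> cotangent Qs \<Longrightarrow> h (cot_act g w) = h w"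
    and z: "z \<in> U" and min: "\<And>w. w \<in> U \<Longrightarrow> Phi w = Phi z \<Longrightarrow> h z \<le> h w"
  shows "local_extremum (reduced_space Qs (Phi z)) (induced h) (orbit cot_act (isotropy (Phi z)) z)"
proof -
  define ob where "ob = orbit cot_act (isotropy (Phi z))"
  define S where "S = momentum_level Qs (Phi z)"
  have UQ: "U \<subseteq> cotangent Qs" using U(1) openin_imp_subset by blast
  have sub: "isotropy (Phi z) \<subseteq> G" by (auto simp: isotropy_def)
  have induced: "induced h (ob w) = h w" if "w \<in> U" for w
  proof -
    have "h x = h w" if "x \<in> ob w" for x
      using that \<open>w \<in> U\<close> UQ inv sub unfolding ob_def orbit_def by blast
    then have "h ` ob w = {h w}"
      using mem_orbit_isotropy[of w "Phi z"] unfolding ob_def by blast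
    then show ?thesis by (simp add: induced_def)
  qed
  have pull: "x \<in> U" if "ob x = ob y" "y \<in> U" for x y
  proof -
    have "x \<in> ob y" using that(1) mem_orbit_isotropy[of x "Phi z"] by (simp add: ob_def)
    then show ?thesis using U(2) that(2) sub unfolding ob_def orbit_def by blast
  qed
  have "{x \<in> S. ob x \<in> ob ` (S \<inter> U)} = S \<inter> U"
    using pull by auto
  moreover have "openin (top_of_set S) (S \<inter> U)"
    using U(1) by (auto simp: openin_open S_def momentum_level_def)
  ultimately have "openin (reduced_space Qs (Phi z)) (ob ` (S \<inter> U))"
    unfolding reduced_space_def openin_orbit_topology ob_def[symmetric] S_def[symmetric] by auto
  moreover have "ob z \<in> ob ` (S \<inter> U)"
    using z UQ by (auto simp: S_def momentum_level_def)
  moreover have "induced h (ob z) \<le> induced h y" if "y \<in> ob ` (S \<inter> U)" for y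
    using that min z by (auto simp: induced S_def momentum_level_def)
  ultimately show ?thesis unfolding local_extremum_def ob_def by blast
qed

lemma rot_commute: "A ** rot A t = rot A t ** A"
  by (simp add: rot_def Let_def matrix_bilinear_simps matrix_mul_assoc)

lemma inf_cot_act_one_param:
  assumes "\<zeta> \<in> so3 \<times> so3"
  shows "inf_cot_act \<zeta> (cot_act (one_param \<zeta> t) z) = cot_act (one_param \<zeta> t) (inf_cot_act \<zeta> z)"
proof -
  have "snd \<zeta> ** transpose (rot (snd \<zeta>) t) = transpose (rot (snd \<zeta>) t) ** snd \<zeta>"
    using arg_cong[OF rot_commute[of "snd \<zeta>" t], of transpose] assms
    by (auto simp: transpose_simps so3_transpose matrix_bilinear_simps)
  then have "inf_act \<zeta> (conf_act (one_param \<zeta> t) A) = conf_act (one_param \<zeta> t) (inf_act \<zeta> A)" for A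
    unfolding inf_act_def conf_act_def one_param_def
    by (simp add: matrix_bilinear_simps matrix_mul_assoc rot_commute) (simp flip: matrix_mul_assoc)
  then show ?thesis by (simp add: inf_cot_act_def cot_act_def)
qed

lemma invariant_derivative_zero:
  assumes Qs: "Qs = SL3 \<or> Qs = GL3" and w: "w \<in> cotangent Qs"
    and inv: "\<And>g w. g \<in> G \<Longrightarrow> w \<in> cotangent Qs \<Longrightarrow> h (cot_act g w) = (h w :: real)"
    and E: "(h has_derivative E) (at w within cotangent Qs)" and \<zeta>: "\<zeta> \<in> so3 \<times> so3"
  shows "E (inf_cot_act \<zeta> w) = 0"
proof -
  let ?c = "\<lambda>s. cot_act (one_param \<zeta> s) w"
  have "(?c has_derivative (\<lambda>s. s *\<^sub>R inf_cot_act \<zeta> w)) (at 0)"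
    using cot_act_one_param_derivative[OF \<zeta>, of w 0] by (simp add: has_vector_derivative_def)
  moreover have "range ?c \<subseteq> cotangent Qs"
    using cot_act_mem[OF Qs one_param_mem[OF \<zeta>] w] by auto
  ultimately have "((\<lambda>s. h (?c s)) has_derivative (\<lambda>s. E (s *\<^sub>R inf_cot_act \<zeta> w))) (at 0)"
    using E by (intro has_derivative_in_compose[where f = ?c and g = h]) (auto intro: has_derivative_subset)
  moreover have "(\<lambda>s. h (?c s)) = (\<lambda>s. h w)"
    using inv[OF one_param_mem[OF \<zeta>] w] by auto
  ultimately have "(\<lambda>s. E (s *\<^sub>R inf_cot_act \<zeta> w)) = (\<lambda>s. 0)"
    using has_derivative_unique has_derivative_const by metis
  from fun_cong[OF this, of 1] show ?thesis by simp
qed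

lemma symplectic_form_skew: "symplectic_form v w = - symplectic_form w v"
  by (simp add: symplectic_form_def inner_commute)

text \<open>Where \<open>h\<close> and \<open>momentum \<zeta>\<close> have the same differential, they have the same Hamiltonian vector, and by
  equivariance this persists along the one-parameter group of \<open>\<zeta>\<close>. By Noether's theorem this group then fixes the momentum.\<close>
lemma relative_equilibrium_one_param:
  assumes Qs: "Qs = SL3 \<or> Qs = GL3" and z: "z \<in> cotangent Qs"
    and inv: "\<And>g w. g \<in> G \<Longrightarrow> w \<in> cotangent Qs \<Longrightarrow> h (cot_act g w) = (h w :: real)"
    and D: "(h has_derivative D) (at z within cotangent Qs)" and \<zeta>: "\<zeta> \<in> so3 \<times> so3"
    and crit: "\<And>v. D v = symplectic_form (inf_cot_act \<zeta> z) v"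
  shows "relative_equilibrium Qs h (\<lambda>t. cot_act (one_param \<zeta> t) z)"
    and "one_param \<zeta> t \<in> isotropy (Phi z)"
proof -
  define c where "c t = cot_act (one_param \<zeta> t) z" for t
  have G: "one_param \<zeta> t \<in> G" for t by (rule one_param_mem[OF \<zeta>])
  have c_mem: "c t \<in> cotangent Qs" for t
    unfolding c_def by (rule cot_act_mem[OF Qs G z])
  have dc: "(c has_vector_derivative inf_cot_act \<zeta> (c t)) (at t)" for t
    using cot_act_one_param_derivative[OF \<zeta>] by (simp add: c_def[abs_def])
  have dh: "(h has_derivative symplectic_form (inf_cot_act \<zeta> (c t))) (at (c t) within cotangent Qs)" for t
  proof -
    let ?g = "one_param \<zeta> t"
    have pull: "cot_act (G_inv ?g) (c t) = z" by (simp add: c_def cot_act_inv G)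
    have "((\<lambda>w. h (cot_act (G_inv ?g) w)) has_derivative (\<lambda>v. D (cot_act (G_inv ?g) v)))
        (at (c t) within cotangent Qs)"
    proof (rule has_derivative_in_compose[where f = "cot_act (G_inv ?g)" and f' = "cot_act (G_inv ?g)"])
      show "(cot_act (G_inv ?g) has_derivative cot_act (G_inv ?g)) (at (c t) within cotangent Qs)"
        by (rule bounded_linear_imp_has_derivative[OF bounded_linear_cot_act])
      show "(h has_derivative D) (at (cot_act (G_inv ?g) (c t)) within cot_act (G_inv ?g) ` cotangent Qs)"
        unfolding pull
        by (rule has_derivative_subset[OF D]) (auto intro: cot_act_mem[OF Qs G_inv_mem[OF G]])
    qed
    moreover have "D (cot_act (G_inv ?g) v) = symplectic_form (inf_cot_act \<zeta> (c t)) v" for v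
      using symplectic_form_cot_act[OF G[of t], of "inf_cot_act \<zeta> z" "cot_act (G_inv ?g) v"]
      by (simp add: crit c_def cot_act_inv G inf_cot_act_one_param[OF \<zeta>])
    ultimately have "((\<lambda>w. h (cot_act (G_inv ?g) w)) has_derivative symplectic_form (inf_cot_act \<zeta> (c t)))
        (at (c t) within cotangent Qs)" by simp
    then show ?thesis
      by (rule has_derivative_transform[OF c_mem, rotated]) (simp add: inv G_inv_mem[OF G])
  qed
  have "momentum \<zeta>' (c t) = momentum \<zeta>' z" if \<zeta>': "\<zeta>' \<in> so3 \<times> so3" for \<zeta>' t
  proof -
    have "((\<lambda>t. momentum \<zeta>' (c t)) has_real_derivative 0) (at t)" for t
    proof -
      have "((\<lambda>t. momentum \<zeta>' (c t)) has_derivative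
          (\<lambda>s. symplectic_form (inf_cot_act \<zeta>' (c t)) (s *\<^sub>R inf_cot_act \<zeta> (c t)))) (at t)"
        by (rule has_derivative_compose[OF dc[unfolded has_vector_derivative_def] momentum_has_derivative[OF \<zeta>']])
      moreover have "symplectic_form (inf_cot_act \<zeta>' (c t)) (s *\<^sub>R inf_cot_act \<zeta> (c t)) = 0" for s
        using invariant_derivative_zero[OF Qs c_mem inv dh \<zeta>', of t]
          symplectic_form_skew[of "inf_cot_act \<zeta>' (c t)" "inf_cot_act \<zeta> (c t)"]
        by (simp add: symplectic_form_def[of _ "s *\<^sub>R _"] symplectic_form_def[symmetric]
            flip: right_diff_distrib)
      ultimately show ?thesis by (simp add: has_field_derivative_def flip: lambda_zero)
    qed
    then have "momentum \<zeta>' (c t) = momentum \<zeta>' (c 0)"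
      by (rule DERIV_isconst_all[rule_format])
    then show ?thesis by (simp add: c_def)
  qed
  then have "Phi (c t) = Phi z" for t by (rule Phi_eqI)
  then show iso: "one_param \<zeta> t \<in> isotropy (Phi z)" for t
    using Phi_equivariant[OF G] by (simp add: c_def isotropy_def G)
  have "hamiltonian_vector Qs h (c t) (inf_cot_act \<zeta> (c t))" for t
    unfolding hamiltonian_vector_def
  proof (intro conjI exI ballI)
    have "((\<lambda>s. cot_act (one_param \<zeta> s) (c t)) has_vector_derivative inf_cot_act \<zeta> (c t)) (at 0)"
      using cot_act_one_param_derivative[OF \<zeta>, of "c t" 0] by simp
    then show "inf_cot_act \<zeta> (c t) \<in> tangent_space (cotangent Qs) (c t)"
      unfolding tangent_space_def using cot_act_mem[OF Qs G c_mem]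
      by (intro CollectI exI[of _ "\<lambda>s. cot_act (one_param \<zeta> s) (c t)"]) simp
  qed (rule dh refl)+
  then have "trajectory Qs h c" using c_mem dc unfolding trajectory_def by blast
  moreover have "orbit cot_act G (c t) = orbit cot_act G z" for t
    using orbit_isotropy_cot_act[of "one_param \<zeta> t" 0 z] G by (simp add: c_def G_eq_isotropy)
  ultimately show "relative_equilibrium Qs h (\<lambda>t. cot_act (one_param \<zeta> t) z)"
    unfolding relative_equilibrium_def c_def[abs_def] by blast
qed

text \<open>Composition with the retraction extends \<open>h\<close> to an invariant function \<open>f\<close> on an open set. It has the
  same minimum, and its differential restricts to that of \<open>h\<close>.\<close>
lemma extremal_relative_equilibrium_of_minimum:
  assumes Qs: "Qs = SL3 \<or> Qs = GL3"
    and h: "h differentiable_on cotangent Qs"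
    and inv: "\<And>g w. g \<in> G \<Longrightarrow> w \<in> cotangent Qs \<Longrightarrow> h (cot_act g w) = (h w :: real)"
    and U: "openin (top_of_set (cotangent Qs)) U" "\<And>g w. g \<in> G \<Longrightarrow> w \<in> U \<Longrightarrow> cot_act g w \<in> U"
    and z: "z \<in> U" and min: "\<And>w. w \<in> U \<Longrightarrow> Phi w = Phi z \<Longrightarrow> h z \<le> h w"
  obtains c where "extremal_relative_equilibrium Qs h (Phi z) c" "range c \<subseteq> U"
proof -
  obtain \<Omega> r where \<Omega>: "open \<Omega>" "cotangent Qs \<subseteq> \<Omega>"
    and r: "\<And>z. z \<in> \<Omega> \<Longrightarrow> r z \<in> cotangent Qs \<and> invertible (fst z) \<and> Phi (r z) = Phi z \<and> r differentiable (at z)"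
    and r_equiv: "\<And>g z. g \<in> G \<Longrightarrow> z \<in> \<Omega> \<Longrightarrow> cot_act g z \<in> \<Omega> \<and> r (cot_act g z) = cot_act g (r z)"
    and r_id: "\<And>z. z \<in> cotangent Qs \<Longrightarrow> r z = z"
    using cotangent_retraction[OF Qs] by blast
  obtain V where V: "open V" "U = cotangent Qs \<inter> V" using U(1) by (auto simp: openin_open)
  have zQ: "z \<in> cotangent Qs" "z \<in> V" and z\<Omega>: "z \<in> \<Omega>" using z V \<Omega>(2) by auto
  have contr: "continuous_on \<Omega> r"
    using r by (intro continuous_at_imp_continuous_on ballI differentiable_imp_continuous_within) auto
  define S where "S = \<Omega> \<inter> r -` V"
  have S: "open S" "z \<in> S"
    using continuous_open_preimage[OF contr \<Omega>(1) V(1)] zQ z\<Omega> by (auto simp: S_def r_id)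
  define f where "f w = h (r w)" for w
  have "S \<subseteq> \<Omega>" "r ` S \<subseteq> cotangent Qs" using r unfolding S_def by blast+
  then have contf: "continuous_on S f" unfolding f_def
    using continuous_on_compose2[OF differentiable_imp_continuous_on[OF h] continuous_on_subset[OF contr]]
    by blast
  obtain D0 r' where D0: "(h has_derivative D0) (at z within cotangent Qs)" and r': "(r has_derivative r') (at z)"
    using h zQ(1) r[OF z\<Omega>] by (auto simp: differentiable_on_def differentiable_def)
  have "(f has_derivative (\<lambda>v. D0 (r' v))) (at z within \<Omega>)"
    unfolding f_def
  proof (rule has_derivative_in_compose[where f = r and f' = r'])
    show "(r has_derivative r') (at z within \<Omega>)" using r' has_derivative_at_withinI by blast
    show "(h has_derivative D0) (at (r z) within r ` \<Omega>)"
      unfolding r_id[OF zQ(1)] by (rule has_derivative_subset[OF D0]) (use r in auto)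
  qed
  then obtain D where D: "(f has_derivative D) (at z)"
    using at_within_open[OF z\<Omega> \<Omega>(1)] by auto
  have "f (cot_act g w) = f w" if "g \<in> G" "w \<in> S" for g w
    using that r r_equiv inv by (simp add: f_def S_def)
  moreover have "f z \<le> f w" if "w \<in> S" "Phi w = Phi z" for w
    unfolding f_def r_id[OF zQ(1)] using that r V(2) by (intro min) (auto simp: S_def)
  ultimately obtain \<zeta> where \<zeta>: "\<zeta> \<in> so3 \<times> so3" "\<And>v. D v = symplectic_form (inf_cot_act \<zeta> z) v"
    using critical_point_on_momentum_level[OF S contf D] r[OF z\<Omega>] by blast
  have Dh: "(h has_derivative D) (at z within cotangent Qs)"
    using has_derivative_at_withinI[OF D]
    by (rule has_derivative_transform[OF zQ(1), rotated]) (simp add: f_def r_id)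
  let ?c = "\<lambda>t. cot_act (one_param \<zeta> t) z"
  note rel = relative_equilibrium_one_param[OF Qs zQ(1) inv Dh \<zeta>]
  have "Phi (?c t) = Phi z" for t
    using Phi_equivariant[OF one_param_mem[OF \<zeta>(1)]] rel(2) by (simp add: isotropy_def)
  moreover have "local_extremum (reduced_space Qs (Phi z)) (induced h) (orbit cot_act (isotropy (Phi z)) (?c t))" for t
  proof -
    have eq: "orbit cot_act (isotropy (Phi z)) (?c t) = orbit cot_act (isotropy (Phi z)) z"
      by (rule orbit_isotropy_cot_act[OF rel(2)])
    show ?thesis
      unfolding eq using local_extremum_reduced_space[where h = h, OF U inv z min] by blast
  qed
  ultimately have "extremal_relative_equilibrium Qs h (Phi z) ?c"
    using rel(1) by (simp add: extremal_relative_equilibrium_def)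
  moreover have "range ?c \<subseteq> U" using U(2)[OF one_param_mem[OF \<zeta>(1)] z] by auto
  ultimately show ?thesis by (rule that)
qed

section \<open>Norms on a finite-dimensional space\<close>

text \<open>An expansion in an orthonormal basis bounds \<open>N\<close> above by the Euclidean norm. So \<open>N\<close> is continuous and
  has a positive minimum on the unit sphere of \<open>S\<close>.\<close>
lemma is_norm_on_lower_bound:
  fixes S :: "'a::euclidean_space set"
  assumes S: "subspace S" and N: "is_norm_on S N"
  obtains c where "c > 0" "\<And>x. x \<in> S \<Longrightarrow> c * norm x \<le> N x"
proof -
  have pos: "0 \<le> N x" "N x = 0 \<longleftrightarrow> x = 0" if "x \<in> S" for x
    using N that by (auto simp: is_norm_on_def)
  have scale: "N (a *\<^sub>R x) = \<bar>a\<bar> * N x" if "x \<in> S" for a x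
    using N that by (auto simp: is_norm_on_def)
  have tri: "N (x + y) \<le> N x + N y" if "x \<in> S" "y \<in> S" for x y
    using N that by (auto simp: is_norm_on_def)
  obtain B where B: "B \<subseteq> S" "pairwise orthogonal B" "\<And>x. x \<in> B \<Longrightarrow> norm x = 1"
    "independent B" "span B = S"
    using orthonormal_basis_subspace[OF S] by metis
  have fin: "finite B" using B(4) independent_imp_finite by blast
  have sum_le: "(\<Sum>b\<in>A. f b *\<^sub>R b) \<in> S \<and> N (\<Sum>b\<in>A. f b *\<^sub>R b) \<le> (\<Sum>b\<in>A. \<bar>f b\<bar> * N b)"
    if "finite A" "A \<subseteq> S" for A and f :: "'a \<Rightarrow> real"
    using that
  proof (induction A)
    case empty
    then show ?case using pos(2)[of 0] subspace_0[OF S] by simp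
  next
    case (insert b A)
    then have "f b *\<^sub>R b \<in> S" by (simp add: subspace_scale[OF S])
    then show ?case
      using insert tri[of "f b *\<^sub>R b" "\<Sum>b\<in>A. f b *\<^sub>R b"] scale[of b "f b"]
      by (auto simp: subspace_add[OF S])
  qed
  define L where "L = (\<Sum>b\<in>B. N b)"
  have L0: "L \<ge> 0" using pos(1) B(1) by (auto simp: L_def intro!: sum_nonneg)
  have upper: "N x \<le> L * norm x" if "x \<in> S" for x
  proof -
    have "N x = N (\<Sum>b\<in>B. (x \<bullet> b) *\<^sub>R b)"
      using orthonormal_basis_expand[OF B(2,3) _ fin, of x] that B(5) by simp
    also have "\<dots> \<le> (\<Sum>b\<in>B. \<bar>x \<bullet> b\<bar> * N b)" using sum_le[OF fin B(1)] by blast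
    also have "\<dots> \<le> (\<Sum>b\<in>B. norm x * N b)"
    proof (intro sum_mono mult_right_mono)
      fix b assume b: "b \<in> B"
      show "\<bar>x \<bullet> b\<bar> \<le> norm x" using Cauchy_Schwarz_ineq2[of x b] B(3)[OF b] by simp
      show "0 \<le> N b" using pos(1) B(1) b by blast
    qed
    finally show ?thesis by (simp add: L_def sum_distrib_left mult.commute)
  qed
  have lip: "\<bar>N x - N y\<bar> \<le> L * norm (x - y)" if "x \<in> S" "y \<in> S" for x y
  proof -
    have d: "x - y \<in> S" "y - x \<in> S" using that by (simp_all add: subspace_diff[OF S])
    have "N x \<le> N (x - y) + N y" "N y \<le> N (y - x) + N x"
      using tri[OF d(1) that(2)] tri[OF d(2) that(1)] by simp_all
    then show ?thesis using upper[OF d(1)] upper[OF d(2)] by (simp add: norm_minus_commute)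
  qed
  have cont: "continuous_on (S \<inter> sphere 0 1) N"
    unfolding continuous_on_iff
  proof (intro ballI allI impI)
    fix x e assume x: "x \<in> S \<inter> sphere 0 1" and e: "(e::real) > 0"
    have "\<bar>N y - N x\<bar> < e" if "y \<in> S" "norm (y - x) < e / (L + 1)" for y
    proof -
      have "(L + 1) * norm (y - x) < e" using that(2) L0 by (simp add: field_simps)
      then show ?thesis using lip[of y x] x that(1) by (simp add: algebra_simps) (smt (verit) norm_ge_zero)
    qed
    then show "\<exists>d>0. \<forall>y\<in>S \<inter> sphere 0 1. dist y x < d \<longrightarrow> dist (N y) (N x) < e"
      using e L0 by (intro exI[of _ "e / (L + 1)"]) (auto simp: dist_norm)
  qed
  show ?thesis
  proof (cases "S \<inter> sphere 0 1 = {}")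
    case True
    have "x = 0" if "x \<in> S" for x
    proof (rule ccontr)
      assume "x \<noteq> 0"
      then have "(1 / norm x) *\<^sub>R x \<in> S \<inter> sphere 0 1" using that by (simp add: subspace_scale[OF S])
      then show False using True by blast
    qed
    then show ?thesis using pos by (intro that[of 1]) auto
  next
    case False
    have "compact (S \<inter> sphere 0 1)"
      using closed_subspace[OF S] by (intro closed_Int_compact) auto
    then obtain u where u: "u \<in> S \<inter> sphere 0 1" "\<And>x. x \<in> S \<inter> sphere 0 1 \<Longrightarrow> N u \<le> N x"
      using continuous_attains_inf[OF _ False cont] by blast
    have "N u > 0" using pos[of u] u(1) by force
    moreover have "N u * norm x \<le> N x" if "x \<in> S" for x
    proof (cases "x = 0")
      case True
      then show ?thesis using pos that by simp
    next
      case x: False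
      then have "(1 / norm x) *\<^sub>R x \<in> S \<inter> sphere 0 1" using that by (simp add: subspace_scale[OF S])
      then have "N u \<le> (1 / norm x) * N x" using u(2) scale[OF that, of "1 / norm x"] by fastforce
      then show ?thesis using x by (simp add: field_simps)
    qed
    ultimately show ?thesis by (rule that)
  qed
qed

section \<open>Tubes around the round configurations\<close>

definition SO3 :: "mat3 set" where "SO3 = {L. rotation_matrix L}"

lemma compact_SO3: "compact SO3"
proof -
  have eq: "SO3 = {L. transpose L ** L = mat 1} \<inter> {L. det L = 1}"
    by (auto simp: SO3_def rotation_matrix_def orthogonal_matrix)
  have "closed SO3"
    unfolding eq by (intro closed_Int closed_Collect_eq continuous_intros continuous_on_id)
  moreover have "norm L = norm (mat 1 :: mat3)" if "L \<in> SO3" for L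
    using norm_conf_act[of "(L, mat 1)" "mat 1"] that
    by (simp add: SO3_def G_iff conf_act_def transpose_simps rotation_matrix_def orthogonal_matrix_id)
  then have "bounded SO3" unfolding bounded_iff by (metis order_refl)
  ultimately show ?thesis by (simp add: compact_eq_bounded_closed)
qed

lemma mat_1_SO3: "mat 1 \<in> SO3"
  by (simp add: SO3_def rotation_matrix_def orthogonal_matrix_id)

lemma infdist_SO3_attained:
  obtains L where "L \<in> SO3" "infdist Q SO3 = dist Q L"
  using infdist_attains_inf[OF compact_imp_closed[OF compact_SO3]] mat_1_SO3 by blast

lemma infdist_SO3_conf_act:
  assumes "g \<in> G"
  shows "infdist (conf_act g Q) SO3 = infdist Q SO3"
proof -
  have le: "infdist (conf_act g Q) SO3 \<le> infdist Q SO3" if "g \<in> G" for g Q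
  proof -
    obtain L where L: "L \<in> SO3" "infdist Q SO3 = dist Q L" by (rule infdist_SO3_attained)
    have "conf_act g L \<in> SO3"
      using that L(1) by (simp add: SO3_def conf_act_def G_iff rotation_matrix_mult rotation_matrix_transpose)
    then have "infdist (conf_act g Q) SO3 \<le> dist (conf_act g Q) (conf_act g L)" by (rule infdist_le)
    also have "\<dots> = dist Q L"
      using norm_conf_act[OF that, of "Q - L"] by (simp add: dist_norm linear_diff[OF linear_conf_act])
    finally show ?thesis by (simp add: L)
  qed
  show ?thesis
    using le[OF assms, of Q] le[OF G_inv_mem[OF assms], of "conf_act g Q"] by (simp add: conf_act_inv assms)
qed

text \<open>Modulo \<open>G\<close>, a configuration close to a rotation is close to the identity.\<close>
lemma near_identity:
  obtains g where "g \<in> G" "dist (conf_act g Q) (mat 1) = infdist Q SO3"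
proof -
  obtain L where L: "L \<in> SO3" "infdist Q SO3 = dist Q L" by (rule infdist_SO3_attained)
  define g where "g = (transpose L, mat 1 :: mat3)"
  have g: "g \<in> G" using L(1) mat_1_SO3 by (simp add: g_def G_iff SO3_def rotation_matrix_transpose)
  have gL: "conf_act g L = mat 1"
    using L(1) by (simp add: g_def conf_act_def SO3_def transpose_simps rotation_matrixD)
  have "dist (conf_act g Q) (mat 1) = dist Q L"
    using norm_conf_act[OF g, of "Q - L"] by (simp add: dist_norm linear_diff[OF linear_conf_act] gL)
  then show ?thesis using that g L gL by simp
qed

lemma orbit_mat_1: "orbit conf_act G (mat 1) \<subseteq> SO3"
  by (auto simp: orbit_def conf_act_def G_iff SO3_def rotation_matrix_mult rotation_matrix_transpose)

definition tube :: "mat3 set \<Rightarrow> real \<Rightarrow> (mat3 \<times> mat3) set" where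
  "tube Qs r = {z \<in> cotangent Qs. infdist (fst z) SO3 \<le> r \<and> norm (snd z) \<le> r}"

definition open_tube :: "mat3 set \<Rightarrow> real \<Rightarrow> (mat3 \<times> mat3) set" where
  "open_tube Qs r = {z \<in> cotangent Qs. infdist (fst z) SO3 < r \<and> norm (snd z) < r}"

lemma openin_open_tube: "openin (top_of_set (cotangent Qs)) (open_tube Qs r)"
proof -
  have "open ({z. infdist (fst z) SO3 < r} \<inter> {z :: mat3 \<times> mat3. norm (snd z) < r})"
    by (intro open_Int open_Collect_less continuous_intros)
  moreover have "open_tube Qs r = cotangent Qs \<inter> ({z. infdist (fst z) SO3 < r} \<inter> {z. norm (snd z) < r})"
    by (auto simp: open_tube_def)
  ultimately show ?thesis unfolding openin_open by blast
qed

lemma cot_act_open_tube: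
  assumes "Qs = SL3 \<or> Qs = GL3" "g \<in> G" "z \<in> open_tube Qs r"
  shows "cot_act g z \<in> open_tube Qs r"
  using assms cot_act_mem[OF assms(1,2)]
  by (simp add: open_tube_def) (simp add: cot_act_def infdist_SO3_conf_act norm_conf_act)

text \<open>For \<open>SL(3)\<close> the phase space is closed. For \<open>GL(3)\<close> it is not, but a matrix close to a rotation is
  invertible, so that a thin tube keeps away from the singular matrices.\<close>
lemma compact_tube:
  assumes Qs: "Qs = SL3 \<or> Qs = GL3"
  obtains r0 where "r0 > 0" "\<And>r. 0 < r \<Longrightarrow> r < r0 \<Longrightarrow> compact (tube Qs r)"
proof -
  define C where "C r = {Q. infdist Q SO3 \<le> r} \<times> cball (0::mat3) r" for r
  have C: "compact (C r)" if "r > 0" for r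
    unfolding C_def using compact_infdist_le[OF _ compact_SO3 that] mat_1_SO3 by (intro compact_Times) auto
  have tube: "tube Qs r = C r \<inter> cotangent Qs" for r
    by (auto simp: tube_def C_def)
  show ?thesis using Qs
  proof
    assume SL: "Qs = SL3"
    have "closed (cotangent Qs)"
      unfolding SL cotangent_SL3 Collect_conj_eq
      by (intro closed_Int closed_Collect_eq continuous_on_inner continuous_on_const continuous_on_snd continuous_on_id
          continuous_on_compose2[OF continuous_on_det3[of UNIV]] continuous_on_compose2[OF continuous_on_cof[of UNIV]]
          continuous_on_fst) auto
    then show ?thesis
      using C by (intro that[of 1]) (simp_all add: tube compact_Int_closed)
  next
    assume GL: "Qs = GL3"
    have "mat 1 \<in> GL3" by (simp add: GL3_def invertible_iff_det)
    then obtain e where e: "e > 0" "ball (mat 1) e \<subseteq> GL3" using open_GL3 by (meson openE)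
    have "Q \<in> GL3" if r: "infdist Q SO3 \<le> r" "r < e" for Q r
    proof -
      obtain g where g: "g \<in> G" "dist (conf_act g Q) (mat 1) = infdist Q SO3" by (rule near_identity)
      then have "conf_act g Q \<in> GL3" using r e(2) by (auto simp: dist_commute subset_iff)
      then have "conf_act (G_inv g) (conf_act g Q) \<in> GL3"
        using conf_act_mem[of GL3] G_inv_mem[OF g(1)] by blast
      then show ?thesis by (simp add: conf_act_inv g)
    qed
    then have "tube Qs r = C r" if "r < e" for r
      using that unfolding tube unfolding GL cotangent_GL3 by (auto simp: C_def)
    then show ?thesis using C e(1) by (intro that[of e]) auto
  qed
qed

section \<open>Momentum values near the round configuration\<close>

definition axes :: "real \<Rightarrow> 3 \<Rightarrow> real" where
  "axes s i = (if i = 1 then s else if i = 2 then 1 else 1 / s)"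

definition ellipsoid :: "real \<Rightarrow> mat3" where
  "ellipsoid s = (\<chi> i j. if i = j then axes s i else 0)"

text \<open>At a configuration with three distinct semi-axes every momentum value is attained by exactly one
  covector with vanishing diagonal, the solution of a \<open>2 \<times> 2\<close> linear system for each pair of axes.\<close>
definition ellipsoid_covector :: "real \<Rightarrow> mat3 \<times> mat3 \<Rightarrow> mat3" where
  "ellipsoid_covector s \<mu> = (\<chi> i j. if i = j then 0 else
     2 * (axes s j * fst \<mu> $ i $ j + axes s i * snd \<mu> $ i $ j) / ((axes s j)\<^sup>2 - (axes s i)\<^sup>2))"

lemma axes_simps: "axes s 1 = s" "axes s 2 = 1" "axes s 3 = 1 / s"
  by (simp_all add: axes_def)

lemma linear_ellipsoid_covector: "linear (ellipsoid_covector s)"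
  by (rule linearI) (auto simp: ellipsoid_covector_def vec_eq_iff add_divide_distrib[symmetric] algebra_simps)

lemma det_ellipsoid: "s \<noteq> 0 \<Longrightarrow> det (ellipsoid s) = 1"
  by (simp add: det_3 ellipsoid_def axes_simps)

lemma ellipsoid_covector_cotangent:
  assumes "Qs = SL3 \<or> Qs = GL3" "s \<noteq> 0"
  shows "(ellipsoid s, ellipsoid_covector s \<mu>) \<in> cotangent Qs"
proof -
  have "cof (ellipsoid s) \<bullet> ellipsoid_covector s \<mu> = 0"
    by (simp add: inner_mat3 cof_components ellipsoid_def ellipsoid_covector_def)
  moreover have "ellipsoid s \<in> GL3"
    using assms(2) by (simp add: GL3_def invertible_iff_det det_ellipsoid)
  ultimately show ?thesis using assms det_ellipsoid[of s]
    by (auto simp: cotangent_SL3 cotangent_GL3)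
qed

lemma so3_eqI_components:
  assumes "A \<in> so3" "B \<in> so3" "A$1$2 = B$1$2" "A$1$3 = B$1$3" "A$2$3 = B$2$3"
  shows "A = B"
  using assms(3-) by (simp add: mat3_eq_iff so3_components[OF assms(1)] so3_components[OF assms(2)])

lemma Phi_ellipsoid:
  assumes \<mu>: "\<mu> \<in> so3 \<times> so3" and s: "s > 1"
  shows "Phi (ellipsoid s, ellipsoid_covector s \<mu>) = \<mu>"
proof -
  have L: "fst \<mu> \<in> so3" and R: "snd \<mu> \<in> so3" using \<mu> by auto
  note comps = so3_components[OF L] so3_components[OF R]
  have solve: "(2 * (b * l + a * r) / (b\<^sup>2 - a\<^sup>2)) * b - a * (2 * (a * - l + b * - r) / (a\<^sup>2 - b\<^sup>2)) = 2 * l"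
    "(2 * (a * - l + b * - r) / (a\<^sup>2 - b\<^sup>2)) * b - a * (2 * (b * l + a * r) / (b\<^sup>2 - a\<^sup>2)) = 2 * r"
    if "a\<^sup>2 \<noteq> b\<^sup>2" for a b l r :: real
  proof -
    have n: "b\<^sup>2 - a\<^sup>2 \<noteq> 0" using that by simp
    have e: "2 * (a * - l + b * - r) / (a\<^sup>2 - b\<^sup>2) = 2 * (a * l + b * r) / (b\<^sup>2 - a\<^sup>2)"
      using n that by (simp add: divide_simps) algebra
    show "(2 * (b * l + a * r) / (b\<^sup>2 - a\<^sup>2)) * b - a * (2 * (a * - l + b * - r) / (a\<^sup>2 - b\<^sup>2)) = 2 * l"
      "(2 * (a * - l + b * - r) / (a\<^sup>2 - b\<^sup>2)) * b - a * (2 * (b * l + a * r) / (b\<^sup>2 - a\<^sup>2)) = 2 * r"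
      unfolding e using n by (simp_all add: divide_simps) algebra+
  qed
  have ne: "(axes s 1)\<^sup>2 \<noteq> (axes s 2)\<^sup>2" "(axes s 1)\<^sup>2 \<noteq> (axes s 3)\<^sup>2" "(axes s 2)\<^sup>2 \<noteq> (axes s 3)\<^sup>2"
  proof -
    have "s\<^sup>2 > 1" using s by (simp add: one_less_power)
    moreover have "(1 / s)\<^sup>2 < 1" using s by (simp add: power_divide \<open>s\<^sup>2 > 1\<close>)
    ultimately show "(axes s 1)\<^sup>2 \<noteq> (axes s 2)\<^sup>2" "(axes s 1)\<^sup>2 \<noteq> (axes s 3)\<^sup>2" "(axes s 2)\<^sup>2 \<noteq> (axes s 3)\<^sup>2"
      by (simp_all add: axes_simps)
  qed
  let ?z = "(ellipsoid s, ellipsoid_covector s \<mu>)"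
  have E: "ellipsoid s $ i $ j = (if i = j then axes s i else 0)" for i j by (simp add: ellipsoid_def)
  have P: "ellipsoid_covector s \<mu> $ i $ j = (if i = j then 0 else
     2 * (axes s j * fst \<mu> $ i $ j + axes s i * snd \<mu> $ i $ j) / ((axes s j)\<^sup>2 - (axes s i)\<^sup>2))" for i j
    by (simp add: ellipsoid_covector_def)
  have Phi_L: "Phi_L ?z $ i $ j = (P $ i $ j * axes s j - axes s i * P $ j $ i) / 2"
    if "P = ellipsoid_covector s \<mu>" for i j P
    using exhaust_3[of i] exhaust_3[of j]
    by (auto simp: Phi_L_def matrix_mult_component_3 transpose_def E that)
  have Phi_R: "Phi_R ?z $ i $ j = (P $ j $ i * axes s j - axes s i * P $ i $ j) / 2"
    if "P = ellipsoid_covector s \<mu>" for i j P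
    using exhaust_3[of i] exhaust_3[of j]
    by (auto simp: Phi_R_def matrix_mult_component_3 transpose_def E that)
  have "Phi_L ?z = fst \<mu>"
  proof (rule so3_eqI_components[OF Phi_mem_so3(1) L])
    show "Phi_L ?z $1$2 = fst \<mu> $1$2" "Phi_L ?z $1$3 = fst \<mu> $1$3" "Phi_L ?z $2$3 = fst \<mu> $2$3"
      unfolding Phi_L[OF refl] P comps using solve(1)[OF ne(1)] solve(1)[OF ne(2)] solve(1)[OF ne(3)] by simp_all
  qed
  moreover have "Phi_R ?z = snd \<mu>"
  proof (rule so3_eqI_components[OF Phi_mem_so3(2) R])
    show "Phi_R ?z $1$2 = snd \<mu> $1$2" "Phi_R ?z $1$3 = snd \<mu> $1$3" "Phi_R ?z $2$3 = snd \<mu> $2$3"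
      unfolding Phi_R[OF refl] P comps using solve(2)[OF ne(1)] solve(2)[OF ne(2)] solve(2)[OF ne(3)] by simp_all
  qed
  ultimately show ?thesis by (simp add: Phi_def)
qed

lemma ellipsoid_tendsto: "(ellipsoid \<longlongrightarrow> mat 1) (at_right 1)"
proof (rule vec_tendstoI, rule vec_tendstoI)
  fix i j :: 3
  have "((\<lambda>s::real. 1 / s) \<longlongrightarrow> 1 / 1) (at_right 1)"
    by (intro tendsto_intros) auto
  moreover have "((\<lambda>s::real. s) \<longlongrightarrow> 1) (at_right 1)" by (rule tendsto_ident_at)
  ultimately have "((\<lambda>s. axes s i) \<longlongrightarrow> 1) (at_right 1)"
    by (cases "i = 1"; cases "i = 2") (simp_all add: axes_def)
  then show "((\<lambda>s. ellipsoid s $ i $ j) \<longlongrightarrow> mat 1 $ i $ j) (at_right 1)"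
    by (cases "i = j") (simp_all add: ellipsoid_def mat_def)
qed

section \<open>Energy minima on momentum levels\<close>

lemma zero_mem_tangent_space: "x \<in> S \<Longrightarrow> 0 \<in> tangent_space S x"
  by (auto simp: tangent_space_def intro!: exI[of _ "\<lambda>t. x"])

lemma kinetic_energy_sign:
  assumes "affine_rigid_body Qs K V" "(Q, P) \<in> cotangent Qs"
  shows "K (Q, 0) = 0" "K (Q, P) \<ge> 0" "P \<noteq> 0 \<Longrightarrow> K (Q, P) > 0"
proof -
  have Q: "Q \<in> Qs" and P: "P \<in> tangent_space Qs Q" using assms(2) by (auto simp: cotangent_def)
  have pd: "pos_def_quadratic_form_on (tangent_space Qs Q) (\<lambda>P. K (Q, P))"
    using assms(1) Q by (simp add: affine_rigid_body_def)
  then obtain B where B: "bilinear B" "\<And>p. p \<in> tangent_space Qs Q \<Longrightarrow> K (Q, p) = B p p"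
    by (auto simp: pos_def_quadratic_form_on_def)
  show K0: "K (Q, 0) = 0"
    using B(2)[OF zero_mem_tangent_space[OF Q]] bilinear_lzero[OF B(1)] by simp
  show pos: "K (Q, P) > 0" if "P \<noteq> 0"
    using pd P that by (auto simp: pos_def_quadratic_form_on_def)
  show "K (Q, P) \<ge> 0" using K0 pos by (cases "P = 0") auto
qed

lemma hamiltonian_differentiable_on:
  assumes "affine_rigid_body Qs K V"
  shows "hamiltonian K V differentiable_on cotangent Qs"
proof -
  have K: "K differentiable_on cotangent Qs" and V: "V differentiable_on Qs"
    using assms by (auto simp: affine_rigid_body_def)
  have "(\<lambda>z. V (fst z)) differentiable (at z within cotangent Qs)" if z: "z \<in> cotangent Qs" for z
  proof -
    have sub: "fst ` cotangent Qs \<subseteq> Qs" by (auto simp: cotangent_def)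
    then obtain D where "(V has_derivative D) (at (fst z) within Qs)"
      using V z by (auto simp: differentiable_on_def differentiable_def)
    then have "(V has_derivative D) (at (fst z) within fst ` cotangent Qs)"
      using sub by (rule has_derivative_subset)
    from has_derivative_in_compose[OF has_derivative_fst[OF has_derivative_ident] this]
    show ?thesis unfolding differentiable_def by blast
  qed
  then show ?thesis
    using K by (auto simp: hamiltonian_def[abs_def] differentiable_on_def intro!: differentiable_add)
qed

lemma hamiltonian_cot_act:
  assumes "affine_rigid_body Qs K V" "g \<in> G" "z \<in> cotangent Qs"
  shows "hamiltonian K V (cot_act g z) = hamiltonian K V z"
  using assms by (auto simp: affine_rigid_body_def hamiltonian_def cot_act_def cotangent_def)

text \<open>Invariance spreads the minimum at the identity to a neighbourhood of all rotations.\<close>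
lemma potential_minimum_tube:
  assumes Qs: "Qs = SL3 \<or> Qs = GL3" and arb: "affine_rigid_body Qs K V"
    and V: "potential_minimum Qs V (mat 1)"
  obtains d where "d > 0" "\<And>Q. Q \<in> Qs \<Longrightarrow> infdist Q SO3 < d \<Longrightarrow>
    V (mat 1) \<le> V Q \<and> (V Q = V (mat 1) \<longrightarrow> infdist Q SO3 = 0)"
proof -
  obtain d where d: "d > 0" "\<And>Q. Q \<in> Qs \<Longrightarrow> Q \<noteq> mat 1 \<Longrightarrow> dist Q (mat 1) < d \<Longrightarrow>
      V (mat 1) \<le> V Q \<and> (V Q = V (mat 1) \<longrightarrow> Q \<in> orbit conf_act G (mat 1))"
    using V unfolding potential_minimum_def eventually_at by blast
  show ?thesis
  proof (rule that[OF d(1)])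
    fix Q assume Q: "Q \<in> Qs" "infdist Q SO3 < d"
    obtain g where g: "g \<in> G" "dist (conf_act g Q) (mat 1) = infdist Q SO3" by (rule near_identity)
    have Vg: "V (conf_act g Q) = V Q" using arb g Q by (simp add: affine_rigid_body_def)
    have Qg: "conf_act g Q \<in> Qs" using Qs g(1) Q(1) by (rule conf_act_mem)
    show "V (mat 1) \<le> V Q \<and> (V Q = V (mat 1) \<longrightarrow> infdist Q SO3 = 0)"
    proof (cases "conf_act g Q = mat 1")
      case True
      then show ?thesis using Vg g(2) by simp
    next
      case False
      from d(2)[OF Qg False] have "V (mat 1) \<le> V Q" "V Q = V (mat 1) \<longrightarrow> conf_act g Q \<in> SO3"
        using g Q Vg orbit_mat_1 by auto
      moreover have "infdist Q SO3 = 0" if "conf_act g Q \<in> SO3"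
        using infdist_SO3_conf_act[OF g(1), of Q] that by simp
      ultimately show ?thesis by blast
    qed
  qed
qed

text \<open>On the boundary of a thin tube around the round configurations at rest the energy is at least
  some \<open>m > V (mat 1)\<close>, while covectors at a nearly round ellipsoid with distinct axes attain all small momenta
  with energy below \<open>m\<close>. So a minimum over the compact tube with given momentum is interior.\<close>
lemma momentum_level_minimum:
  assumes Qs: "Qs = SL3 \<or> Qs = GL3" and arb: "affine_rigid_body Qs K V"
    and V: "potential_minimum Qs V (mat 1)"
  obtains r e where "r > 0" "e > 0"
    "\<And>\<mu>. \<mu> \<in> so3 \<times> so3 \<Longrightarrow> norm \<mu> < e \<Longrightarrow> \<exists>z\<in>open_tube Qs r. Phi z = \<mu> \<and>
      (\<forall>w\<in>open_tube Qs r. Phi w = \<mu> \<longrightarrow> hamiltonian K V z \<le> hamiltonian K V w)"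
proof -
  let ?h = "hamiltonian K V"
  have conth: "continuous_on (cotangent Qs) ?h"
    using differentiable_imp_continuous_on[OF hamiltonian_differentiable_on[OF arb]] .
  have contV: "continuous_on Qs V"
    using arb differentiable_imp_continuous_on by (auto simp: affine_rigid_body_def)
  have contPhi: "continuous_on UNIV Phi"
    using Phi_has_derivative has_derivative_continuous by (metis continuous_at_imp_continuous_on)
  obtain d where d: "d > 0" "\<And>Q. Q \<in> Qs \<Longrightarrow> infdist Q SO3 < d \<Longrightarrow>
    V (mat 1) \<le> V Q \<and> (V Q = V (mat 1) \<longrightarrow> infdist Q SO3 = 0)"
    using potential_minimum_tube[OF assms] by blast
  obtain r0 where r0: "r0 > 0" "\<And>r. 0 < r \<Longrightarrow> r < r0 \<Longrightarrow> compact (tube Qs r)"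
    using compact_tube[OF Qs] by blast
  define r where "r = min d r0 / 2"
  have r: "0 < r" "r < d" "r < r0" using d(1) r0(1) by (auto simp: r_def)
  have cpt: "compact (tube Qs r)" using r0(2) r by blast
  have sub: "tube Qs r \<subseteq> cotangent Qs" by (auto simp: tube_def)
  define B where "B = tube Qs r \<inter> ({z. infdist (fst z) SO3 = r} \<union> {z. norm (snd z) = r})"
  have "closed ({z. infdist (fst z) SO3 = r} \<union> {z :: mat3 \<times> mat3. norm (snd z) = r})"
    by (intro closed_Un closed_Collect_eq continuous_intros)
  then have B: "compact B" unfolding B_def by (intro compact_Int_closed cpt)
  have h_B: "?h z > V (mat 1)" if "z \<in> B" for z
  proof -
    obtain Q P where z: "z = (Q, P)" by (metis surj_pair)
    have QP: "(Q, P) \<in> cotangent Qs" "Q \<in> Qs" "infdist Q SO3 \<le> r" and bd: "infdist Q SO3 = r \<or> norm P = r"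
      using that by (auto simp: B_def tube_def z cotangent_def)
    have VQ: "V (mat 1) \<le> V Q" "V Q = V (mat 1) \<longrightarrow> infdist Q SO3 = 0"
      using d(2)[OF QP(2)] QP(3) r(2) by auto
    from bd show ?thesis
    proof
      assume "infdist Q SO3 = r"
      then have "V (mat 1) < V Q" using VQ r(1) by force
      then show ?thesis using kinetic_energy_sign(2)[OF arb QP(1)] by (simp add: z hamiltonian_def)
    next
      assume "norm P = r"
      then have "P \<noteq> 0" using r(1) by auto
      then show ?thesis using kinetic_energy_sign(3)[OF arb QP(1)] VQ(1) by (simp add: z hamiltonian_def)
    qed
  qed
  obtain m where m: "m > V (mat 1)" "\<And>z. z \<in> B \<Longrightarrow> m \<le> ?h z"
  proof (cases "B = {}")
    case True
    then show ?thesis by (intro that[of "V (mat 1) + 1"]) auto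
  next
    case False
    have "B \<subseteq> cotangent Qs" using sub unfolding B_def by blast
    then obtain b where "b \<in> B" "\<forall>z\<in>B. ?h b \<le> ?h z"
      using continuous_attains_inf[OF B False continuous_on_subset[OF conth]] by blast
    then show ?thesis using h_B by (intro that[of "?h b"]) auto
  qed
  have one: "mat 1 \<in> Qs" using Qs by (auto simp: SL3_def GL3_def invertible_iff_det)
  have cot: "(ellipsoid s, ellipsoid_covector s \<mu>) \<in> cotangent Qs" if "s > 1" for s \<mu>
    using ellipsoid_covector_cotangent[OF Qs] that by simp
  have ev1: "\<forall>\<^sub>F s::real in at_right 1. s > 1" by (rule eventually_at_right_less)
  have "((\<lambda>s. V (ellipsoid s)) \<longlongrightarrow> V (mat 1)) (at_right 1)"
    using contV ellipsoid_tendsto one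
    by (rule continuous_on_tendsto_compose) (use cot in \<open>auto intro: eventually_mono[OF ev1] simp: cotangent_def\<close>)
  then have ev2: "\<forall>\<^sub>F s in at_right 1. V (ellipsoid s) < m" using m(1) by (rule order_tendstoD)
  have ev3: "\<forall>\<^sub>F s in at_right 1. dist (ellipsoid s) (mat 1) < r"
    using ellipsoid_tendsto r(1) by (rule tendstoD)
  obtain s where s: "s > 1" "V (ellipsoid s) < m" "dist (ellipsoid s) (mat 1) < r"
    using eventually_happens[OF eventually_conj[OF ev1 eventually_conj[OF ev2 ev3]]] by auto
  let ?z = "\<lambda>\<mu>. (ellipsoid s, ellipsoid_covector s \<mu>)"
  have blin: "bounded_linear (ellipsoid_covector s)"
    using linear_ellipsoid_covector by (simp add: linear_conv_bounded_linear)
  have contz: "continuous_on UNIV ?z"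
    by (intro continuous_intros linear_continuous_on blin)
  then have conthz: "continuous_on UNIV (\<lambda>\<mu>. ?h (?z \<mu>))"
    by (rule continuous_on_compose2[OF conth]) (use cot[OF s(1)] in auto)
  have z0: "ellipsoid_covector s 0 = 0" using linear_0[OF linear_ellipsoid_covector] .
  have "?h (?z 0) < m"
    using kinetic_energy_sign(1)[OF arb cot[OF s(1), of 0]] s(2) by (simp add: z0 hamiltonian_def)
  then have "open ({\<mu>. ?h (?z \<mu>) < m} \<inter> {\<mu>. norm (ellipsoid_covector s \<mu>) < r})"
    "0 \<in> {\<mu>. ?h (?z \<mu>) < m} \<inter> {\<mu>. norm (ellipsoid_covector s \<mu>) < r}"
    using r(1) by (auto simp: z0 intro!: open_Int open_Collect_less conthz continuous_on_norm
        linear_continuous_on[OF blin])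
  then obtain e where e: "e > 0" "ball 0 e \<subseteq> {\<mu>. ?h (?z \<mu>) < m} \<inter> {\<mu>. norm (ellipsoid_covector s \<mu>) < r}"
    by (meson openE)
  show ?thesis
  proof (rule that[OF r(1) e(1)])
    fix \<mu> assume \<mu>: "\<mu> \<in> so3 \<times> so3" "norm \<mu> < e"
    then have "?h (?z \<mu>) < m" "norm (ellipsoid_covector s \<mu>) < r" using e(2) by auto
    moreover have "infdist (ellipsoid s) SO3 < r"
      using infdist_le[OF mat_1_SO3, of "ellipsoid s"] s(3) by simp
    ultimately have z: "?z \<mu> \<in> tube Qs r \<inter> Phi -` {\<mu>}" "?h (?z \<mu>) < m"
      using cot[OF s(1)] Phi_ellipsoid[OF \<mu>(1) s(1)] by (auto simp: tube_def)
    have "closed (Phi -` {\<mu>})" by (rule closed_vimage[OF _ contPhi]) auto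
    then have cptM: "compact (tube Qs r \<inter> Phi -` {\<mu>})" by (rule compact_Int_closed[OF cpt])
    have neM: "tube Qs r \<inter> Phi -` {\<mu>} \<noteq> {}" using z(1) by blast
    have contM: "continuous_on (tube Qs r \<inter> Phi -` {\<mu>}) ?h"
      using conth by (rule continuous_on_subset) (use sub in blast)
    obtain w where w: "w \<in> tube Qs r \<inter> Phi -` {\<mu>}"
      "\<And>y. y \<in> tube Qs r \<inter> Phi -` {\<mu>} \<Longrightarrow> ?h w \<le> ?h y"
      using continuous_attains_inf[OF cptM neM contM] by blast
    have "?h w < m" using w(2)[OF z(1)] z(2) by simp
    then have "\<not> m \<le> ?h w" by simp
    then have "w \<notin> B" using m(2) by blast
    then have "w \<in> open_tube Qs r" "Phi w = \<mu>"
      using w(1) by (auto simp: B_def tube_def open_tube_def)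
    moreover have "open_tube Qs r \<subseteq> tube Qs r" by (auto simp: open_tube_def tube_def)
    ultimately show "\<exists>z\<in>open_tube Qs r. Phi z = \<mu> \<and>
      (\<forall>w\<in>open_tube Qs r. Phi w = \<mu> \<longrightarrow> hamiltonian K V z \<le> hamiltonian K V w)"
      using w(2) by blast
  qed
qed

section \<open>Existence of extremal relative equilibria\<close>

theorem corollary6:
  fixes Qs :: "mat3 set"
    and K :: "mat3 \<times> mat3 \<Rightarrow> real"
    and V :: "mat3 \<Rightarrow> real"
    and N :: "mat3 \<Rightarrow> real"
  assumes "Qs = SL3 \<or> Qs = GL3"
    and "affine_rigid_body Qs K V"
    and "potential_minimum Qs V (mat 1)"
    and "is_norm_on so3 N"
  shows "\<exists>\<epsilon>\<^sub>L > 0. \<exists>\<epsilon>\<^sub>R > 0. \<exists>U.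
    openin (top_of_set (cotangent Qs)) U \<and> (mat 1, 0) \<in> U \<and>
    (\<forall>g\<in>G. \<forall>z\<in>U. cot_act g z \<in> U) \<and>
    (\<forall>\<mu>\<^sub>L\<in>so3. \<forall>\<mu>\<^sub>R\<in>so3. N \<mu>\<^sub>L < \<epsilon>\<^sub>L \<and> N \<mu>\<^sub>R < \<epsilon>\<^sub>R \<longrightarrow>
      (\<exists>c. extremal_relative_equilibrium Qs (hamiltonian K V) (\<mu>\<^sub>L, \<mu>\<^sub>R) c \<and> range c \<subseteq> U))"
proof -
  note Qs = assms(1) and arb = assms(2)
  obtain r e where r: "r > 0" and e: "e > 0"
    and minimum: "\<And>\<mu>. \<mu> \<in> so3 \<times> so3 \<Longrightarrow> norm \<mu> < e \<Longrightarrow> \<exists>z\<in>open_tube Qs r. Phi z = \<mu> \<and>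
      (\<forall>w\<in>open_tube Qs r. Phi w = \<mu> \<longrightarrow> hamiltonian K V z \<le> hamiltonian K V w)"
    using momentum_level_minimum[OF assms(1-3)] by blast
  obtain k where k: "k > 0" "\<And>x. x \<in> so3 \<Longrightarrow> k * norm x \<le> N x"
    using is_norm_on_lower_bound[OF subspace_so3 assms(4)] by blast
  have one: "mat 1 \<in> Qs" using Qs by (auto simp: SL3_def GL3_def invertible_iff_det)
  have "\<exists>c. extremal_relative_equilibrium Qs (hamiltonian K V) (\<mu>\<^sub>L, \<mu>\<^sub>R) c \<and> range c \<subseteq> open_tube Qs r"
    if \<mu>: "\<mu>\<^sub>L \<in> so3" "\<mu>\<^sub>R \<in> so3" "N \<mu>\<^sub>L < k * e / 2" "N \<mu>\<^sub>R < k * e / 2" for \<mu>\<^sub>L \<mu>\<^sub>R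
  proof -
    have "k * norm \<mu>\<^sub>L < k * (e / 2)" "k * norm \<mu>\<^sub>R < k * (e / 2)"
      using k(2)[OF \<mu>(1)] k(2)[OF \<mu>(2)] \<mu>(3,4) by simp_all
    then have "norm \<mu>\<^sub>L < e / 2" "norm \<mu>\<^sub>R < e / 2" using k(1) by simp_all
    then have "norm (\<mu>\<^sub>L, \<mu>\<^sub>R) < e" using norm_Pair_le[of \<mu>\<^sub>L \<mu>\<^sub>R] by linarith
    then obtain z where z: "z \<in> open_tube Qs r" "Phi z = (\<mu>\<^sub>L, \<mu>\<^sub>R)"
      "\<And>w. w \<in> open_tube Qs r \<Longrightarrow> Phi w = Phi z \<Longrightarrow> hamiltonian K V z \<le> hamiltonian K V w"
      using minimum[of "(\<mu>\<^sub>L, \<mu>\<^sub>R)"] \<mu>(1,2) by auto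
    show ?thesis
      by (rule extremal_relative_equilibrium_of_minimum[OF Qs hamiltonian_differentiable_on[OF arb]
            hamiltonian_cot_act[OF arb] openin_open_tube cot_act_open_tube[OF Qs] z(1,3)])
         (auto simp: z(2))
  qed
  moreover have "(mat 1, 0) \<in> open_tube Qs r"
    using r one mat_1_SO3 zero_mem_tangent_space[OF one] by (simp add: open_tube_def cotangent_def)
  ultimately show ?thesis
    using openin_open_tube cot_act_open_tube[OF Qs] k(1) e
    by (intro exI[of _ "k * e / 2"] exI[of _ "open_tube Qs r"] conjI) auto
qed

end
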